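(* Let $b_0=\sqrt{\gamma^2\mu_X/(2\sigma_X^2)}$. As $s\to\infty$: (i) If $\alpha\in(0,1/2)$, the mean congestion level satisfies $$\mu_Q=O\bigl(\exp(-b^2s^{1-2\alpha})\bigr)$$ for any constant $b\in(0,b_0)$ (if $\gamma$, hence $b_0$, depends on $s$: for any constant $b$ with $0<b<\liminf_{s\to\infty}b_0$). (ii) If $\alpha\in[1/2,\infty)$, the mean congestion level is given by $$\mu_Q=s^{\alpha}\,\frac{\sigma_X^2}{2\mu_X\gamma}\,\Bigl(1+O\bigl(s^{\max(1/2-\alpha,-1)}\bigr)\Bigr).$$
   Context: Let $X$ be a non-negative integer-valued random variable with mean $\mu_X>0$, variance $\sigma_X^2$ and probability generating function $X(z)=\sum_{j\ge 0}\mathbb{P}(X=j)z^j$, whose radius of convergence is $r>1$, and such that $|X(z)|<X(r_1)$ for all $z$ with $|z|=r_1$, $z\ne r_1$, and any $r_1\in(0,r)$. For positive integers $n,s$ the demand per period $A(k)$, $k=1,2,\dots$, is a sequence of i.i.d. random variables, each distributed as $A=X_1+\dots+X_n$, the sum of $n$ i.i.d. copies of $X$. The congestion process is the Markov chain $Q_0=0$, $Q_{k+1}=\max\{Q_k+A(k)-s,0\}$. It is assumed that $0<n\mu_X<s$ and that $\mathbb{P}(A=j)>0$ for some $j>s$. Let $Q$ have the stationary distribution of this chain and let $\mu_Q=\mathbb{E}Q$. The system is scaled so that, along a sequence $s\to\infty$ with $n=n(s)$, $X$ fixed and $\alpha>0$ fixed, $$\rho_s=\frac{n\mu_X}{s}=1-\frac{\gamma}{s^{\alpha}},$$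 with $\gamma>0$ (possibly depending on $s$) bounded away from $0$ and $\infty$ as $s\to\infty$. *)

theory Defs
  imports "HOL-Probability.Probability"
begin

abbreviation mean_pmf :: "nat pmf \<Rightarrow> real" where
  "mean_pmf p \<equiv> measure_pmf.expectation p real"

abbreviation variance_pmf :: "nat pmf \<Rightarrow> real" where
  "variance_pmf p \<equiv> measure_pmf.variance p real"

definition pgf :: "nat pmf \<Rightarrow> 'a :: {real_normed_field, banach} \<Rightarrow> 'a" where
  "pgf p z = (\<Sum>j. of_real (pmf p j) * z ^ j)"

abbreviation pgf_radius :: "nat pmf \<Rightarrow> ereal" where
  "pgf_radius p \<equiv> conv_radius (pmf p)"

definition demand_pmf :: "nat pmf \<Rightarrow> nat \<Rightarrow> nat pmf" where
  "demand_pmf p n = map_pmf (\<lambda>x. \<Sum>i<n. x i) (Pi_pmf {..<n} 0 (\<lambda>_. p))"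

(* Subtraction on nat truncates, so q + a - s is max (q + a - s) 0. *)
definition congestion_kernel :: "nat pmf \<Rightarrow> nat \<Rightarrow> nat \<Rightarrow> nat \<Rightarrow> nat pmf" where
  "congestion_kernel p n s q = map_pmf (\<lambda>a. q + a - s) (demand_pmf p n)"

definition stationary_pmf :: "('a \<Rightarrow> 'a pmf) \<Rightarrow> 'a pmf \<Rightarrow> bool" where
  "stationary_pmf K q \<longleftrightarrow> bind_pmf q K = q"

end

theory Submission
  imports Defs "HOL-Real_Asymp.Real_Asymp"
begin

text \<open>
  Write \<open>Y = A - s\<close> for the net input of one period, \<open>d = s - n \<mu>\<close> for its mean deficit, so that
  \<open>d = \<gamma> s\<^sup>1\<^sup>-\<^sup>\<alpha>\<close>, and \<open>U = max {s - Q - A, 0}\<close> for the capacity left idle. Then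
  \<open>Q' = Q + Y + U\<close> with \<open>Q' U = 0\<close>. Everything is read off from stationarity, \<open>E f(Q') = E f(Q)\<close>,
  with well-chosen \<open>f\<close>.

  The functions \<open>q\<close> and \<open>q\<^sup>2\<close> give \<open>E U = d\<close> and
  \<open>2 d E Q = n \<sigma>\<^sup>2 + d\<^sup>2 - E U\<^sup>2\<close> (\<open>stationary_mean_formula\<close>). Dividing, \<open>E Q\<close> equals
  \<open>s\<^sup>\<alpha> \<sigma>\<^sup>2 / (2 \<mu> \<gamma>)\<close> times \<open>1 + \<epsilon>\<close> with
  \<open>\<epsilon> = - \<gamma> s\<^sup>-\<^sup>\<alpha> + (d\<^sup>2 - E U\<^sup>2) \<mu> / (s \<sigma>\<^sup>2)\<close>. So part (ii) comes down to one estimate,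
  \<open>E U\<^sup>2 = O(sqrt s E U)\<close>: when the server idles, it wastes an amount of the order of the fluctuations
  of the demand. It yields \<open>\<epsilon> = O(s powr (1/2 - \<alpha>))\<close>, which is at most the claimed order.

  For this estimate take \<open>f(q) = exp(- t q)\<close>, which gives \<open>\<phi>(t) = M(t) E exp(- t Q)\<close> with
  \<open>\<phi>(t) = E (exp(t U) - 1)\<close> and \<open>M(t) = E exp(- t Y) - 1\<close>. Since \<open>E exp(- t Q)\<close> decreases in
  \<open>t\<close>, the growth of \<open>\<phi>\<close> from \<open>t\<close> to \<open>2 t\<close> is at most that of \<open>M\<close>, which involves the demand
  alone. At \<open>t = 1 / sqrt s\<close> this growth is bounded uniformly in \<open>s\<close>, and bounded growth forces
  \<open>\<phi>(t) = O(t E U)\<close>; as \<open>t\<^sup>2 U\<^sup>2 / 2 \<le> exp(t U) - 1\<close>, the estimate follows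
  (\<open>stationary_idle_second_moment\<close>, \<open>heavy_traffic_idle_second_moment\<close>).

  For part (i) take \<open>f(q) = exp(\<theta> q)\<close> with \<open>\<theta> > 0\<close>, truncated. If \<open>F = E exp(\<theta> Y) < 1\<close>, then
  \<open>E exp(\<theta> Q) \<le> 1 / (1 - F)\<close> (\<open>stationary_exp_moment\<close>), hence \<open>E Q \<le> F / (\<theta> (1 - F))\<close>. The
  optimal \<open>\<theta>\<close>, about \<open>d / (n \<sigma>\<^sup>2)\<close>, gives \<open>F\<close> of the order
  \<open>exp(- d\<^sup>2 / (2 n \<sigma>\<^sup>2))\<close>, whose exponent is \<open>- b\<^sub>0\<^sup>2 s powr (1 - 2 \<alpha>)\<close> up to a factor tending to
  one. The polynomial factor \<open>1 / \<theta>\<close> and this factor are absorbed by the gap between \<open>b\<close> and the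
  lower limit of \<open>b\<^sub>0\<close>. The same exponential moment shows that \<open>Q\<close> and \<open>Q\<^sup>2\<close> are integrable,
  which the identities above presuppose.
\<close>

section \<open>Expectations over independent pairs\<close>

lemma expectation_pair_pmf_mult:
  fixes f :: "'a \<Rightarrow> real" and g :: "'b \<Rightarrow> real"
  assumes f: "integrable (measure_pmf p) f" "\<And>x. f x \<ge> 0"
    and g: "integrable (measure_pmf q) g" "\<And>y. g y \<ge> 0"
  shows "integrable (measure_pmf (pair_pmf p q)) (\<lambda>z. f (fst z) * g (snd z))" (is ?int)
    and "measure_pmf.expectation (pair_pmf p q) (\<lambda>z. f (fst z) * g (snd z)) =
         measure_pmf.expectation p f * measure_pmf.expectation q g" (is ?eq)
proof -
  have "(\<integral>\<^sup>+z. ennreal (f (fst z) * g (snd z)) \<partial>pair_pmf p q) =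
        (\<integral>\<^sup>+x. ennreal (f x) * (\<integral>\<^sup>+y. ennreal (g y) \<partial>q) \<partial>p)"
    using f g by (simp add: nn_integral_pair_pmf' ennreal_mult nn_integral_cmult)
  also have "\<dots> = ennreal (measure_pmf.expectation p f) * ennreal (measure_pmf.expectation q g)"
    using f g by (simp add: nn_integral_multc nn_integral_eq_integral)
  finally have *: "(\<integral>\<^sup>+z. ennreal (f (fst z) * g (snd z)) \<partial>pair_pmf p q) =
        ennreal (measure_pmf.expectation p f * measure_pmf.expectation q g)"
    using f g by (simp add: ennreal_mult integral_nonneg)
  have nonneg: "0 \<le> measure_pmf.expectation p f * measure_pmf.expectation q g"
    using f g by (simp add: integral_nonneg)
  show ?int ?eq
    using nn_integral_eq_integrable[THEN iffD1, OF _ _ nonneg *] f g by (auto simp: AE_measure_pmf_iff)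
qed

lemma integrable_pair_pmf_marginals:
  fixes f :: "'a \<Rightarrow> real" and g :: "'b \<Rightarrow> real"
  shows "integrable (measure_pmf p) f \<Longrightarrow> integrable (measure_pmf (pair_pmf p q)) (\<lambda>z. f (fst z))"
    and "integrable (measure_pmf q) g \<Longrightarrow> integrable (measure_pmf (pair_pmf p q)) (\<lambda>z. g (snd z))"
  using integrable_map_pmf_eq[of fst "pair_pmf p q" f] integrable_map_pmf_eq[of snd "pair_pmf p q" g]
  by (simp_all add: map_fst_pair_pmf map_snd_pair_pmf)

lemma integrable_pmf_bounded:
  fixes f :: "'a \<Rightarrow> real"
  assumes "\<And>x. \<bar>f x\<bar> \<le> B"
  shows "integrable (measure_pmf p) f"
  by (rule measure_pmf.integrable_const_bound[where B=B]) (use assms in auto)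

section \<open>Demand as a sum of independent copies\<close>

lemma demand_pmf_0: "demand_pmf p 0 = return_pmf 0"
  by (simp add: demand_pmf_def)

lemma demand_pmf_Suc:
  "demand_pmf p (Suc n) = map_pmf (\<lambda>z. fst z + snd z) (pair_pmf p (demand_pmf p n))"
proof -
  have "demand_pmf p (Suc n) = map_pmf (\<lambda>x. \<Sum>i<Suc n. x i)
      (map_pmf (\<lambda>(y,f). f(n:=y)) (pair_pmf p (Pi_pmf {..<n} 0 (\<lambda>_. p))))"
    unfolding demand_pmf_def by (subst Pi_pmf_insert[symmetric]) (auto simp: lessThan_Suc)
  also have "\<dots> = map_pmf (\<lambda>z. fst z + snd z) (pair_pmf p (demand_pmf p n))"
    by (simp add: demand_pmf_def pair_map_pmf2 pmf.map_comp o_def case_prod_unfold add.commute)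
  finally show ?thesis .
qed

text \<open>
  Adding one independent copy multiplies the moment generating function by one factor. The integrability
  claim is part of the induction because the product rule for independent pairs needs it at each step.
\<close>

lemma expectation_exp_demand:
  assumes int: "integrable (measure_pmf p) (\<lambda>j. exp (c * real j))"
  shows "integrable (measure_pmf (demand_pmf p n)) (\<lambda>a. exp (c * real a)) \<and>
         measure_pmf.expectation (demand_pmf p n) (\<lambda>a. exp (c * real a)) =
         measure_pmf.expectation p (\<lambda>j. exp (c * real j)) ^ n"
proof (induction n)
  case 0
  show ?case by (simp add: demand_pmf_0 integrable_measure_pmf_finite)
next
  case (Suc n)
  have eq: "(\<lambda>z. exp (c * real (fst z + snd z))) = (\<lambda>z. exp (c * real (fst z)) * exp (c * real (snd z)))"
    by (simp add: exp_add distrib_left)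
  show ?case
    using Suc expectation_pair_pmf_mult[OF int _ conjunct1[OF Suc]]
    by (simp add: demand_pmf_Suc eq[unfolded of_nat_add] exp_add distrib_left)
qed

text \<open>
  The raw second moment is tracked, and not the variance itself, so that all the products met in the
  induction have nonnegative factors and fall under \<open>expectation_pair_pmf_mult\<close>.
\<close>

lemma demand_moments:
  assumes int: "integrable (measure_pmf p) real" "integrable (measure_pmf p) (\<lambda>j. real j ^ 2)"
  shows "integrable (measure_pmf (demand_pmf p n)) real \<and>
         integrable (measure_pmf (demand_pmf p n)) (\<lambda>a. real a ^ 2) \<and>
         mean_pmf (demand_pmf p n) = real n * mean_pmf p \<and>
         measure_pmf.expectation (demand_pmf p n) (\<lambda>a. real a ^ 2) =
           real n * variance_pmf p + (real n * mean_pmf p)\<^sup>2"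
proof (induction n)
  case 0
  show ?case by (simp add: demand_pmf_0 integrable_measure_pmf_finite)
next
  case (Suc n)
  let ?P = "measure_pmf (pair_pmf p (demand_pmf p n))"
  have sq: "real (i + j) ^ 2 = real i ^ 2 + 2 * (real i * real j) + real j ^ 2" for i j
    by (simp add: power2_eq_square algebra_simps)
  have i1: "integrable ?P (\<lambda>z. real (fst z))" "integrable ?P (\<lambda>z. real (snd z))"
    "integrable ?P (\<lambda>z. real (fst z) ^ 2)" "integrable ?P (\<lambda>z. real (snd z) ^ 2)"
    using Suc int by (auto intro: integrable_pair_pmf_marginals)
  have m: "integrable ?P (\<lambda>z. real (fst z) * real (snd z))"
    "integral\<^sup>L ?P (\<lambda>z. real (fst z) * real (snd z)) = mean_pmf p * (real n * mean_pmf p)"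
    using expectation_pair_pmf_mult[OF int(1) _ conjunct1[OF Suc]] Suc by auto
  have v: "measure_pmf.expectation p (\<lambda>j. real j ^ 2) = variance_pmf p + (mean_pmf p)\<^sup>2"
    using measure_pmf.variance_eq[OF int] by simp
  have e1: "integral\<^sup>L ?P (\<lambda>z. real (fst z)) = mean_pmf p"
    "integral\<^sup>L ?P (\<lambda>z. real (snd z)) = real n * mean_pmf p"
    "integral\<^sup>L ?P (\<lambda>z. real (fst z) ^ 2) = variance_pmf p + (mean_pmf p)\<^sup>2"
    "integral\<^sup>L ?P (\<lambda>z. real (snd z) ^ 2) = real n * variance_pmf p + (real n * mean_pmf p)\<^sup>2"
    using Suc v expectation_pair_pmf_fst[of p "demand_pmf p n" "\<lambda>x. real x ^ 2"]
      expectation_pair_pmf_snd[of p "demand_pmf p n" "\<lambda>x. real x ^ 2"]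
    by simp_all
  have "integral\<^sup>L ?P (\<lambda>z. real (fst z) ^ 2 + 2 * (real (fst z) * real (snd z)) + real (snd z) ^ 2) =
      (variance_pmf p + (mean_pmf p)\<^sup>2) + 2 * (mean_pmf p * (real n * mean_pmf p)) +
      (real n * variance_pmf p + (real n * mean_pmf p)\<^sup>2)"
    using i1 m by (simp add: e1)
  also have "\<dots> = real (Suc n) * variance_pmf p + (real (Suc n) * mean_pmf p)\<^sup>2"
    by (simp add: power2_eq_square) algebra
  finally have e2: "integral\<^sup>L ?P (\<lambda>z. real (fst z) ^ 2 + 2 * (real (fst z) * real (snd z)) + real (snd z) ^ 2)
      = real (Suc n) * variance_pmf p + (real (Suc n) * mean_pmf p)\<^sup>2" .
  have e3: "integral\<^sup>L ?P (\<lambda>z. real (fst z) + real (snd z)) = real (Suc n) * mean_pmf p"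
    using i1 Suc by (simp add: e1 distrib_right)
  show ?case
    unfolding demand_pmf_Suc integral_map_pmf integrable_map_pmf_eq sq e2
    unfolding of_nat_add e3
    using i1 m(1) by (intro conjI Bochner_Integration.integrable_add integrable_mult_right) auto
qed

section \<open>Stationary identities for the congestion recursion\<close>

lemma stationary_congestion_iff:
  "stationary_pmf (congestion_kernel p n s) Q \<longleftrightarrow>
   map_pmf (\<lambda>z. fst z + snd z - s) (pair_pmf Q (demand_pmf p n)) = Q"
  by (simp add: stationary_pmf_def congestion_kernel_def[abs_def] pair_pmf_def map_bind_pmf map_pmf_def
     bind_assoc_pmf bind_return_pmf)

text \<open>
  Stationarity as an exchange of test functions: one period after a stationary start has the law of the
  start. All information on the stationary law is drawn from this equation.
\<close>

lemma expectation_stationary: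
  fixes f :: "nat \<Rightarrow> real"
  assumes stat: "map_pmf (\<lambda>z. fst z + snd z - s) (pair_pmf Q D) = Q"
  shows "measure_pmf.expectation (pair_pmf Q D) (\<lambda>z. f (fst z + snd z - s)) =
         measure_pmf.expectation Q f"
proof -
  have "measure_pmf.expectation Q f =
        measure_pmf.expectation (map_pmf (\<lambda>z. fst z + snd z - s) (pair_pmf Q D)) f"
    by (simp only: stat)
  then show ?thesis by simp
qed

text \<open>
  Finiteness of the exponential moment is part of the claim, so the equation
  \<open>E f(Q') = E f(Q)\<close> can only be used for bounded \<open>f\<close>. The choice is
  \<open>f(q) = exp(\<theta> min {q, N})\<close>: above level \<open>N\<close> one period cannot increase \<open>f\<close>, and below it one period
  multiplies \<open>exp(\<theta> q)\<close> by \<open>F\<close> on average, up to the value \<open>1\<close> taken when the queue empties. The part of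
  \<open>E f(Q)\<close> from above \<open>N\<close> therefore cancels, and the part from below satisfies a bound free of \<open>N\<close>.
\<close>

lemma stationary_exp_moment:
  assumes stat: "map_pmf (\<lambda>z. fst z + snd z - s) (pair_pmf Q D) = Q"
    and \<theta>: "\<theta> > 0"
    and int: "integrable (measure_pmf D) (\<lambda>a. exp (\<theta> * real a))"
    and F: "F = exp (- \<theta> * real s) * measure_pmf.expectation D (\<lambda>a. exp (\<theta> * real a))" "F < 1"
  shows "integrable (measure_pmf Q) (\<lambda>q. exp (\<theta> * real q))"
    and "measure_pmf.expectation Q (\<lambda>q. exp (\<theta> * real q)) \<le> 1 / (1 - F)"
proof -
  \<comment> \<open>The function \<open>exp(\<theta> min {q, N})\<close> is split at \<open>N\<close>; only \<open>h\<close> has to be controlled.\<close>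
  define h where "h N q = (if q < N then exp (\<theta> * real q) else 0)" for N q :: nat
  define k where "k N q = (if q < N then 0 else exp (\<theta> * real N))" for N q :: nat
  have h_le: "\<bar>h N q\<bar> \<le> exp (\<theta> * real N)" and k_le: "\<bar>k N q\<bar> \<le> exp (\<theta> * real N)" for N q
    using \<theta> by (auto simp: h_def k_def)
  have ih: "integrable (measure_pmf R) (h N)" and ik: "integrable (measure_pmf R) (k N)" for N R
    by (rule integrable_pmf_bounded[OF h_le], rule integrable_pmf_bounded[OF k_le])
  have bound: "measure_pmf.expectation Q (h N) \<le> 1 / (1 - F)" for N
  proof -
    let ?P = "measure_pmf (pair_pmf Q D)"
    have step: "h N (q + a - s) + k N (q + a - s) \<le> 1 + exp (- \<theta> * real s) * (h N q * exp (\<theta> * real a)) + k N q"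
      for q a
    proof (cases "q < N")
      case True
      have "h N (q + a - s) + k N (q + a - s) \<le> exp (\<theta> * real (q + a - s))"
        using \<theta> by (auto simp: h_def k_def)
      also have "\<dots> \<le> 1 + exp (\<theta> * (real q + real a - real s))"
        by (cases "s \<le> q + a") (auto simp: of_nat_diff)
      also have "exp (\<theta> * (real q + real a - real s)) = exp (- \<theta> * real s) * (h N q * exp (\<theta> * real a))"
        using True by (simp add: h_def exp_add[symmetric] algebra_simps)
      finally show ?thesis using True by (simp add: k_def)
    next
      case False
      then show ?thesis using \<theta> by (auto simp: h_def k_def add_increasing)
    qed
    have m: "integrable ?P (\<lambda>z. h N (fst z) * exp (\<theta> * real (snd z)))"
      "integral\<^sup>L ?P (\<lambda>z. h N (fst z) * exp (\<theta> * real (snd z))) =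
        measure_pmf.expectation Q (h N) * measure_pmf.expectation D (\<lambda>a. exp (\<theta> * real a))"
      by (rule expectation_pair_pmf_mult[OF ih _ int]; simp add: h_def)+
    have ik': "integrable ?P (\<lambda>z. k N (fst z))"
      by (rule integrable_pair_pmf_marginals[OF ik])
    have "measure_pmf.expectation Q (h N) + measure_pmf.expectation Q (k N) =
          measure_pmf.expectation Q (\<lambda>q. h N q + k N q)"
      using ih ik by simp
    also have "\<dots> = integral\<^sup>L ?P (\<lambda>z. h N (fst z + snd z - s) + k N (fst z + snd z - s))"
      by (rule expectation_stationary[OF stat, symmetric])
    also have "\<dots> \<le> integral\<^sup>L ?P (\<lambda>z. 1 + exp (- \<theta> * real s) * (h N (fst z) * exp (\<theta> * real (snd z))) + k N (fst z))"
    proof (rule integral_mono)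
      show "integrable ?P (\<lambda>z. h N (fst z + snd z - s) + k N (fst z + snd z - s))"
        by (rule integrable_pmf_bounded[where B = "exp (\<theta> * real N) + exp (\<theta> * real N)"])
           (rule abs_triangle_ineq[THEN order_trans], rule add_mono[OF h_le k_le])
      show "integrable ?P (\<lambda>z. 1 + exp (- \<theta> * real s) * (h N (fst z) * exp (\<theta> * real (snd z))) + k N (fst z))"
        using m(1) ik' by (intro Bochner_Integration.integrable_add integrable_mult_right) auto
    qed (rule step)
    also have "\<dots> = 1 + F * measure_pmf.expectation Q (h N) + measure_pmf.expectation Q (k N)"
      using m ik' by simp (simp add: F(1))
    finally have "(1 - F) * measure_pmf.expectation Q (h N) \<le> 1"
      by (simp add: algebra_simps)
    then show ?thesis using F(2) by (simp add: field_simps)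
  qed
  have mono: "incseq (\<lambda>N. measure_pmf.expectation Q (h N))"
    by (intro incseq_SucI integral_mono ih) (auto simp: h_def)
  obtain L where L: "(\<lambda>N. measure_pmf.expectation Q (h N)) \<longlonglongrightarrow> L"
    using incseq_convergent[OF mono] bound by metis
  have lim: "(\<lambda>N. h N q) \<longlonglongrightarrow> exp (\<theta> * real q)" for q
  proof (rule tendsto_eventually)
    show "\<forall>\<^sub>F N in sequentially. h N q = exp (\<theta> * real q)"
      using eventually_gt_at_top[of q] by eventually_elim (simp add: h_def)
  qed
  have *: "has_bochner_integral (measure_pmf Q) (\<lambda>q. exp (\<theta> * real q)) L"
    by (rule has_bochner_integral_monotone_convergence[OF ih _ _ L])
       (use lim in \<open>auto simp: mono_def h_def intro!: AE_pmfI\<close>)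
  show "integrable (measure_pmf Q) (\<lambda>q. exp (\<theta> * real q))"
    using * by (simp add: has_bochner_integral_iff)
  show "measure_pmf.expectation Q (\<lambda>q. exp (\<theta> * real q)) \<le> 1 / (1 - F)"
    using * LIMSEQ_le_const2[OF L] bound by (auto simp: has_bochner_integral_iff)
qed

text \<open>
  Since \<open>Q' = Q + Y + U\<close> and \<open>Q' U = 0\<close>, we have \<open>Q'\<^sup>2 + U\<^sup>2 = (Q + Y)\<^sup>2\<close>. Taking expectations, the
  moments of \<open>Q'\<close> and \<open>Q\<close> cancel, and the product of \<open>Q\<close> and the independent \<open>Y\<close> leaves the mean of
  \<open>Q\<close> as the only unknown besides \<open>E U\<^sup>2\<close>.
\<close>

lemma stationary_mean_formula:
  assumes stat: "map_pmf (\<lambda>z. fst z + snd z - s) (pair_pmf Q D) = Q"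
    and D: "integrable (measure_pmf D) real" "integrable (measure_pmf D) (\<lambda>a. real a ^ 2)"
    and Q: "integrable (measure_pmf Q) real" "integrable (measure_pmf Q) (\<lambda>q. real q ^ 2)"
  defines "U \<equiv> \<lambda>z. real (s - (fst z + snd z))"
  shows "measure_pmf.expectation (pair_pmf Q D) U = real s - mean_pmf D"
    and "2 * (real s - mean_pmf D) * mean_pmf Q =
         measure_pmf.expectation D (\<lambda>a. real a ^ 2) - 2 * real s * mean_pmf D + (real s)\<^sup>2
          - measure_pmf.expectation (pair_pmf Q D) (\<lambda>z. U z ^ 2)"
proof -
  let ?P = "measure_pmf (pair_pmf Q D)"
  have U_le: "\<bar>U z\<bar> \<le> real s" "\<bar>U z ^ 2\<bar> \<le> real s ^ 2" for z
    by (auto simp: U_def power_mono)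
  have iU: "integrable ?P U" "integrable ?P (\<lambda>z. U z ^ 2)"
    by (rule integrable_pmf_bounded, rule U_le)+
  have i1: "integrable ?P (\<lambda>z. real (fst z))" "integrable ?P (\<lambda>z. real (snd z))"
    "integrable ?P (\<lambda>z. real (fst z) ^ 2)" "integrable ?P (\<lambda>z. real (snd z) ^ 2)"
    using D Q by (auto intro: integrable_pair_pmf_marginals)
  have m: "integrable ?P (\<lambda>z. real (fst z) * real (snd z))"
    "integral\<^sup>L ?P (\<lambda>z. real (fst z) * real (snd z)) = mean_pmf Q * mean_pmf D"
    using expectation_pair_pmf_mult[OF Q(1) _ D(1)] by auto
  have p1: "real (q + a - s) = real q + real a - real s + U (q, a)" for q a
    by (cases "s \<le> q + a") (auto simp: U_def of_nat_diff)
  have p2: "real (q + a - s) ^ 2 = real q ^ 2 + 2 * (real q * real a) + real a ^ 2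
     - 2 * real s * real q - 2 * real s * real a + real s ^ 2 - U (q, a) ^ 2" for q a
    by (cases "s \<le> q + a") (auto simp: U_def of_nat_diff power2_eq_square algebra_simps)
  have "mean_pmf Q = integral\<^sup>L ?P (\<lambda>z. real (fst z) + real (snd z) - real s + U z)"
    unfolding expectation_stationary[OF stat, symmetric, of real] p1 by simp
  then show "integral\<^sup>L ?P U = real s - mean_pmf D"
    using i1 iU by simp
  have "measure_pmf.expectation Q (\<lambda>q. real q ^ 2) = integral\<^sup>L ?P (\<lambda>z. real (fst z) ^ 2 +
     2 * (real (fst z) * real (snd z)) + real (snd z) ^ 2
     - 2 * real s * real (fst z) - 2 * real s * real (snd z) + real s ^ 2 - U z ^ 2)"
    unfolding expectation_stationary[OF stat, symmetric, of "\<lambda>q. real q ^ 2"] p2 by simp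
  also have "\<dots> = measure_pmf.expectation Q (\<lambda>q. real q ^ 2) + 2 * (mean_pmf Q * mean_pmf D)
     + measure_pmf.expectation D (\<lambda>a. real a ^ 2) - 2 * real s * mean_pmf Q - 2 * real s * mean_pmf D
     + real s ^ 2 - integral\<^sup>L ?P (\<lambda>z. U z ^ 2)"
    using i1 iU m expectation_pair_pmf_fst[of Q D "\<lambda>x. real x ^ 2"]
      expectation_pair_pmf_snd[of Q D "\<lambda>x. real x ^ 2"] by simp
  finally show "2 * (real s - mean_pmf D) * mean_pmf Q =
         measure_pmf.expectation D (\<lambda>a. real a ^ 2) - 2 * real s * mean_pmf D + (real s)\<^sup>2
          - integral\<^sup>L ?P (\<lambda>z. U z ^ 2)"
    by (simp add: algebra_simps)
qed

text \<open>
  Of \<open>Q'\<close> and \<open>U\<close> at least one is zero and \<open>Q' - U = Q + Y\<close>, so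
  \<open>exp(- t Q') + exp(t U) = exp(- t (Q + Y)) + 1\<close> in every outcome. The exponential of the sum factorises by
  independence.
\<close>

lemma stationary_transform_identity:
  assumes stat: "map_pmf (\<lambda>z. fst z + snd z - s) (pair_pmf Q D) = Q" and t: "t \<ge> 0"
  shows "measure_pmf.expectation (pair_pmf Q D) (\<lambda>z. exp (t * real (s - (fst z + snd z))) - 1) =
         (exp (t * real s) * measure_pmf.expectation D (\<lambda>a. exp (- t * real a)) - 1)
         * measure_pmf.expectation Q (\<lambda>q. exp (- t * real q))"
proof -
  let ?P = "measure_pmf (pair_pmf Q D)"
  have b: "integrable (measure_pmf R) (\<lambda>q. exp (- t * real (f q)))" for R :: "'z pmf" and f
    by (rule integrable_pmf_bounded[where B=1]) (use t in auto)
  have bU: "integrable ?P (\<lambda>z. exp (t * real (s - (fst z + snd z))))"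
    by (rule integrable_pmf_bounded[where B="exp (t * real s)"]) (use t in \<open>auto intro!: mult_left_mono\<close>)
  note m = expectation_pair_pmf_mult[OF b[of Q "\<lambda>x. x"] _ b[of D "\<lambda>x. x"], simplified]
  have p: "exp (- t * real (q + a - s)) =
      exp (t * real s) * (exp (- t * real q) * exp (- t * real a)) + 1 - exp (t * real (s - (q + a)))" for q a
    by (cases "s \<le> q + a") (auto simp: of_nat_diff exp_add[symmetric] algebra_simps)
  have "measure_pmf.expectation Q (\<lambda>q. exp (- t * real q)) =
     integral\<^sup>L ?P (\<lambda>z. exp (t * real s) * (exp (- t * real (fst z)) * exp (- t * real (snd z))) + 1
       - exp (t * real (s - (fst z + snd z))))"
    unfolding expectation_stationary[OF stat, symmetric, of "\<lambda>q. exp (- t * real q)"] p ..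
  also have "\<dots> = exp (t * real s) * (measure_pmf.expectation Q (\<lambda>q. exp (- t * real q)) *
       measure_pmf.expectation D (\<lambda>a. exp (- t * real a))) + 1
       - integral\<^sup>L ?P (\<lambda>z. exp (t * real (s - (fst z + snd z))))"
    using m bU by simp
  finally show ?thesis using bU by (simp add: algebra_simps)
qed

text \<open>
  The transform identity lets the hypothesis on \<open>M\<close>, which concerns the demand alone, pass to
  \<open>\<phi>(t) = E (exp(t U) - 1)\<close>: \<open>\<phi>(2 t) \<le> B \<phi>(t)\<close>. If \<open>t U\<close> were often large, \<open>\<phi>\<close> would grow faster than
  that from \<open>t\<close> to \<open>2 t\<close>; so \<open>\<phi>(t)\<close> is governed by its linear part \<open>t E U\<close>, and \<open>\<phi>(t)\<close> dominates
  \<open>t\<^sup>2 E U\<^sup>2 / 2\<close>.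
\<close>

lemma stationary_idle_second_moment:
  assumes stat: "map_pmf (\<lambda>z. fst z + snd z - s) (pair_pmf Q D) = Q" and t: "t > 0"
  defines "M \<equiv> \<lambda>t. exp (t * real s) * measure_pmf.expectation D (\<lambda>a. exp (- t * real a)) - 1"
  assumes M: "M t > 0" "M (2 * t) \<le> B * M t" and B: "B > 0"
  shows "measure_pmf.expectation (pair_pmf Q D) (\<lambda>z. real (s - (fst z + snd z)) ^ 2) \<le>
         8 * B / t * measure_pmf.expectation (pair_pmf Q D) (\<lambda>z. real (s - (fst z + snd z)))"
proof -
  let ?P = "measure_pmf (pair_pmf Q D)"
  define U where "U z = real (s - (fst z + snd z))" for z :: "nat \<times> nat"
  define \<phi> where "\<phi> t = integral\<^sup>L ?P (\<lambda>z. exp (t * U z) - 1)" for t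
  have U: "0 \<le> U z" "U z \<le> real s" for z by (auto simp: U_def)
  have i: "integrable ?P U" "integrable ?P (\<lambda>z. U z ^ 2)"
    by (rule integrable_pmf_bounded[where B="real s"] integrable_pmf_bounded[where B="real s ^ 2"];
        use U in \<open>auto intro!: power_mono\<close>)+
  have ie: "integrable ?P (\<lambda>z. exp (t * U z) - 1)" if "t \<ge> 0" for t
  proof (rule integrable_pmf_bounded[where B="exp (t * real s)"])
    fix z
    have "0 \<le> t * U z" "t * U z \<le> t * real s" using U[of z] that by (auto intro: mult_left_mono)
    then have "1 \<le> exp (t * U z)" "exp (t * U z) \<le> exp (t * real s)" by auto
    then show "\<bar>exp (t * U z) - 1\<bar> \<le> exp (t * real s)" by linarith
  qed
  have "\<phi> (2 * t) = M (2 * t) * measure_pmf.expectation Q (\<lambda>q. exp (- (2 * t) * real q))"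
    using stationary_transform_identity[OF stat, of "2 * t"] t by (simp add: \<phi>_def U_def M_def)
  also have "\<dots> \<le> (B * M t) * measure_pmf.expectation Q (\<lambda>q. exp (- t * real q))"
  proof (rule mult_mono)
    show "measure_pmf.expectation Q (\<lambda>q. exp (- (2 * t) * real q)) \<le> measure_pmf.expectation Q (\<lambda>q. exp (- t * real q))"
      by (rule integral_mono; (rule integrable_pmf_bounded[where B=1])?) (use t in auto)
  qed (use M B in \<open>auto intro!: integral_nonneg\<close>)
  also have "\<dots> = B * \<phi> t"
    using stationary_transform_identity[OF stat, of t] t by (simp add: \<phi>_def U_def M_def)
  finally have growth: "\<phi> (2 * t) \<le> B * \<phi> t" .
  \<comment> \<open>The weight \<open>1 / (2 B)\<close> is chosen so that the growth bound returns half of \<open>\<phi>(t)\<close>, which is then absorbed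
    on the left. Where \<open>exp x\<close> exceeds \<open>2 B\<close> the second term alone suffices, elsewhere the first.\<close>
  have pt: "exp x - 1 \<le> 2 * B * x + (exp (2 * x) - 1) / (2 * B)" if x: "x \<ge> 0" for x :: real
  proof (cases "exp x \<ge> 2 * B")
    case True
    have "2 * B * (exp x - 1) \<le> (exp x + 1) * (exp x - 1)"
      using True x by (intro mult_right_mono) auto
    also have "\<dots> = exp (2 * x) - 1" unfolding exp_double by (simp add: power2_eq_square algebra_simps)
    finally have "exp x - 1 \<le> (exp (2 * x) - 1) / (2 * B)" using B by (simp add: field_simps)
    then show ?thesis using x B by (simp add: add_increasing)
  next
    case False
    have "exp x * (1 - x) \<le> exp x * exp (- x)"
      using exp_ge_add_one_self[of "- x"] by (intro mult_left_mono) auto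
    then have "exp x - 1 \<le> x * exp x" by (simp add: exp_minus algebra_simps)
    also have "\<dots> \<le> x * (2 * B)" using False x by (intro mult_left_mono) auto
    moreover have "0 \<le> (exp (2 * x) - 1) / (2 * B)" using x B by simp
    ultimately show ?thesis by (simp add: mult_ac)
  qed
  have "\<phi> t \<le> integral\<^sup>L ?P (\<lambda>z. 2 * B * (t * U z) + (exp (2 * (t * U z)) - 1) / (2 * B))"
    unfolding \<phi>_def
  proof (rule integral_mono)
    show "integrable ?P (\<lambda>z. 2 * B * (t * U z) + (exp (2 * (t * U z)) - 1) / (2 * B))"
      using ie[of "2 * t"] i t by (simp add: mult.assoc)
  qed (use ie[of t] t U in \<open>auto intro!: pt\<close>)
  also have "\<dots> = 2 * B * t * integral\<^sup>L ?P U + \<phi> (2 * t) / (2 * B)"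
    using ie[of "2 * t"] i t unfolding \<phi>_def by (simp add: mult.assoc)
  also have "\<dots> \<le> 2 * B * t * integral\<^sup>L ?P U + \<phi> t / 2"
    using growth B by (simp add: field_simps)
  finally have first: "\<phi> t \<le> 4 * B * t * integral\<^sup>L ?P U" by simp
  have sq: "t\<^sup>2 / 2 * U z ^ 2 \<le> exp (t * U z) - 1" for z
  proof -
    have x: "0 \<le> t * U z" using U[of z] t by simp
    have "t\<^sup>2 / 2 * U z ^ 2 = (t * U z)\<^sup>2 / 2" by (simp add: power_mult_distrib)
    also have "\<dots> \<le> exp (t * U z) - 1"
      using exp_lower_Taylor_quadratic[OF x] x by linarith
    finally show ?thesis .
  qed
  have "integral\<^sup>L ?P (\<lambda>z. t\<^sup>2 / 2 * U z ^ 2) \<le> \<phi> t"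
    unfolding \<phi>_def by (rule integral_mono) (use i ie[of t] t sq in auto)
  then have "t\<^sup>2 / 2 * integral\<^sup>L ?P (\<lambda>z. U z ^ 2) \<le> 4 * B * t * integral\<^sup>L ?P U"
    using first by simp
  then have "integral\<^sup>L ?P (\<lambda>z. U z ^ 2) \<le> (4 * B * t * integral\<^sup>L ?P U) / (t\<^sup>2 / 2)"
    using t by (subst pos_le_divide_eq) (auto simp: mult.commute)
  also have "\<dots> = 8 * B / t * integral\<^sup>L ?P U"
    using t by (simp add: power2_eq_square)
  finally show ?thesis unfolding U_def .
qed

section \<open>Moments and exponential bounds for one source of demand\<close>

lemma exponential_moment_if_pgf_radius_gt_1:
  assumes "pgf_radius X > 1"
  shows "\<exists>\<eta>>0. integrable (measure_pmf X) (\<lambda>j. exp (\<eta> * real j))"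
proof -
  obtain R where R: "1 < ereal R" "ereal R < pgf_radius X"
    using ereal_dense2[OF assms] by auto
  have "summable (\<lambda>j. norm (pmf X j * R ^ j))"
    using R by (intro abs_summable_in_conv_radius) auto
  then have "integrable (measure_pmf X) (\<lambda>j. exp (ln R * real j))"
    using R by (simp add: measure_pmf_eq_density integrable_density integrable_count_space_nat_iff
        exp_of_nat2_mult abs_mult)
  then show ?thesis using R by (intro exI[of _ "ln R"]) auto
qed

lemma power_le_fact_exp:
  fixes x \<eta> :: real
  assumes "x \<ge> 0" "\<eta> > 0"
  shows "x ^ k \<le> fact k / \<eta> ^ k * exp (\<eta> * x)"
proof -
  have "(\<eta> * x) ^ k / fact k \<le> (\<Sum>i. (\<eta> * x) ^ i /\<^sub>R fact i)"
    using assms sum_le_suminf[OF summable_exp_generic[of "\<eta> * x"], of "{k}"]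
    by (simp add: divide_inverse mult_ac)
  then have "(\<eta> * x) ^ k / fact k \<le> exp (\<eta> * x)" by (simp add: exp_def)
  then show ?thesis using assms by (simp add: field_simps power_mult_distrib)
qed

lemma integrable_power_if_exponential_moment:
  assumes "\<eta> > 0" "integrable (measure_pmf X) (\<lambda>j. exp (\<eta> * real j))"
  shows "integrable (measure_pmf X) (\<lambda>j. real j ^ k)"
  by (rule Bochner_Integration.integrable_bound[OF integrable_mult_right[OF assms(2), of "fact k / \<eta> ^ k"]])
     (use assms power_le_fact_exp[of "real _" \<eta> k] in \<open>auto simp: abs_mult\<close>)

lemma integrable_exp_mono:
  assumes "integrable (measure_pmf X) (\<lambda>j. exp (\<eta> * real j))" "\<theta> \<le> \<eta>"
  shows "integrable (measure_pmf X) (\<lambda>j. exp (\<theta> * real j))"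
  by (rule Bochner_Integration.integrable_bound[OF assms(1)])
     (use assms(2) in \<open>auto intro!: mult_right_mono\<close>)

lemma exp_minus_le_quadratic:
  fixes x :: real assumes "x \<ge> 0"
  shows "exp (- x) \<le> 1 - x + x\<^sup>2 / 2"
proof -
  obtain t where t: "\<bar>t\<bar> \<le> \<bar>- x\<bar>" "exp (- x) = (\<Sum>m<3. (- x) ^ m / fact m) + exp t / fact 3 * (- x) ^ 3"
    using Maclaurin_exp_le[of "- x" 3] by blast
  have "exp t / fact 3 * (- x) ^ 3 \<le> 0"
    using assms by (auto intro!: mult_nonneg_nonpos simp: power3_eq_cube)
  then show ?thesis using t(2) by (simp add: eval_nat_numeral)
qed

lemma exp_le_cubic:
  fixes x :: real
  shows "exp x \<le> 1 + x + x\<^sup>2 / 2 + \<bar>x\<bar> ^ 3 * exp \<bar>x\<bar> / 6"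
proof -
  obtain t where t: "\<bar>t\<bar> \<le> \<bar>x\<bar>" "exp x = (\<Sum>m<3. x ^ m / fact m) + exp t / fact 3 * x ^ 3"
    using Maclaurin_exp_le[of x 3] by blast
  have "exp t * x ^ 3 \<le> exp t * \<bar>x\<bar> ^ 3"
    using abs_ge_self[of "x ^ 3"] by (intro mult_left_mono) (auto simp: power_abs)
  also have "\<dots> \<le> exp \<bar>x\<bar> * \<bar>x\<bar> ^ 3"
    using t(1) by (intro mult_right_mono) auto
  finally have "exp t * x ^ 3 \<le> exp \<bar>x\<bar> * \<bar>x\<bar> ^ 3" .
  then show ?thesis using t(2) by (simp add: eval_nat_numeral mult_ac)
qed

text \<open>
  For nonnegative variables the quadratic upper bound on \<open>exp(- x)\<close> is global, so there is no
  restriction on the size of \<open>t\<close>.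
\<close>

lemma laplace_upper_bound:
  assumes "integrable (measure_pmf X) real" "integrable (measure_pmf X) (\<lambda>j. real j ^ 2)" "t \<ge> 0"
  shows "measure_pmf.expectation X (\<lambda>j. exp (- t * real j)) \<le>
         exp (- t * mean_pmf X + t\<^sup>2 * measure_pmf.expectation X (\<lambda>j. real j ^ 2) / 2)"
proof -
  have "measure_pmf.expectation X (\<lambda>j. exp (- t * real j)) \<le>
        measure_pmf.expectation X (\<lambda>j. 1 - t * real j + t\<^sup>2 / 2 * real j ^ 2)"
  proof (rule integral_mono)
    show "integrable (measure_pmf X) (\<lambda>j. exp (- t * real j))"
      by (rule integrable_pmf_bounded[where B=1]) (use assms in auto)
    show "integrable (measure_pmf X) (\<lambda>j. 1 - t * real j + t\<^sup>2 / 2 * real j ^ 2)"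
      using assms by (intro Bochner_Integration.integrable_add Bochner_Integration.integrable_diff integrable_mult_right) auto
    show "exp (- t * real j) \<le> 1 - t * real j + t\<^sup>2 / 2 * real j ^ 2" for j
      using exp_minus_le_quadratic[of "t * real j"] assms(3) by (simp add: power_mult_distrib)
  qed
  also have "\<dots> = 1 + (- t * mean_pmf X + t\<^sup>2 * measure_pmf.expectation X (\<lambda>j. real j ^ 2) / 2)"
    using assms by simp
  also have "\<dots> \<le> exp (- t * mean_pmf X + t\<^sup>2 * measure_pmf.expectation X (\<lambda>j. real j ^ 2) / 2)"
    by (rule exp_ge_add_one_self)
  finally show ?thesis .
qed

text \<open>
  Convexity alone gives the bound with \<open>c = 0\<close>. A single value \<open>j0\<close> below the mean adds the quadratic gain:
  there the exponent \<open>t (\<mu> - j0)\<close> of the centred transform is nonnegative, and the quadratic lower bound on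
  \<open>exp\<close> holds without restriction on \<open>t\<close>.
\<close>

lemma laplace_lower_bound:
  assumes int: "integrable (measure_pmf X) real" and j0: "real j0 \<le> mean_pmf X" and t: "t \<ge> 0"
  defines "c \<equiv> pmf X j0 * (mean_pmf X - real j0)\<^sup>2 / 2"
  shows "exp (- t * mean_pmf X) * (1 + c * t\<^sup>2) \<le> measure_pmf.expectation X (\<lambda>j. exp (- t * real j))"
proof -
  define \<mu> where "\<mu> = mean_pmf X"
  have i: "integrable (measure_pmf X) (\<lambda>j. t\<^sup>2 * (\<mu> - real j0)\<^sup>2 / 2 * indicator {j0} j)"
    by (rule integrable_pmf_bounded[where B="t\<^sup>2 * (\<mu> - real j0)\<^sup>2 / 2"]) (auto simp: indicator_def)
  have ie: "integrable (measure_pmf X) (\<lambda>j. exp (- t * real j))"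
    by (rule integrable_pmf_bounded[where B=1]) (use t in auto)
  have "1 + c * t\<^sup>2 = measure_pmf.expectation X (\<lambda>j. 1 + t * (\<mu> - real j) + t\<^sup>2 * (\<mu> - real j0)\<^sup>2 / 2 * indicator {j0} j)"
    using int i by (simp add: c_def \<mu>_def measure_pmf_single)
  also have "\<dots> \<le> measure_pmf.expectation X (\<lambda>j. exp (t * \<mu>) * exp (- t * real j))"
  proof (rule integral_mono)
    show "1 + t * (\<mu> - real j) + t\<^sup>2 * (\<mu> - real j0)\<^sup>2 / 2 * indicator {j0} j \<le> exp (t * \<mu>) * exp (- t * real j)" for j
    proof (cases "j = j0")
      case True
      have "0 \<le> t * (\<mu> - real j0)" using t j0 by (simp add: \<mu>_def)
      from exp_lower_Taylor_quadratic[OF this] True show ?thesis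
        by (simp add: exp_add[symmetric] power_mult_distrib) (simp add: algebra_simps)
    next
      case False
      then show ?thesis using exp_ge_add_one_self[of "t * (\<mu> - real j)"]
        by (simp add: exp_add[symmetric] right_diff_distrib)
    qed
  qed (use int i ie in auto)
  also have "\<dots> = exp (t * \<mu>) * measure_pmf.expectation X (\<lambda>j. exp (- t * real j))"
    by simp
  finally have "1 + c * t\<^sup>2 \<le> exp (t * \<mu>) * measure_pmf.expectation X (\<lambda>j. exp (- t * real j))" .
  then have "exp (- t * \<mu>) * (1 + c * t\<^sup>2) \<le>
      exp (- t * \<mu>) * (exp (t * \<mu>) * measure_pmf.expectation X (\<lambda>j. exp (- t * real j)))"
    by (intro mult_left_mono) auto
  then show ?thesis by (simp add: \<mu>_def mult.assoc[symmetric] exp_add[symmetric])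
qed

text \<open>
  The sharp constant \<open>\<sigma>\<^sup>2 / 2\<close> in front of \<open>\<theta>\<^sup>2\<close> determines the exponent of the light-load bound.
  The third-order remainder at \<open>\<theta> (X - \<mu>)\<close> is at most \<open>\<theta>\<^sup>3\<close> times a multiple of \<open>exp(\<eta> X)\<close>, so
  any \<open>v > \<sigma>\<^sup>2 / 2\<close> leaves room for it once \<open>\<theta>\<close> is small.
\<close>

lemma mgf_quadratic_bound:
  assumes \<eta>: "\<eta> > 0" "integrable (measure_pmf X) (\<lambda>j. exp (\<eta> * real j))"
    and v: "variance_pmf X / 2 < v"
  shows "\<exists>\<delta>>0. \<forall>\<theta>. 0 < \<theta> \<and> \<theta> \<le> \<delta> \<longrightarrow> integrable (measure_pmf X) (\<lambda>j. exp (\<theta> * real j)) \<and>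
    measure_pmf.expectation X (\<lambda>j. exp (\<theta> * real j)) \<le> exp (\<theta> * mean_pmf X + v * \<theta>\<^sup>2)"
proof -
  define \<mu> where "\<mu> = mean_pmf X"
  define K where "K = (2 / \<eta>) ^ 3 * exp (\<eta> * \<mu>) * measure_pmf.expectation X (\<lambda>j. exp (\<eta> * real j))"
  define \<delta> where "\<delta> = min (\<eta> / 2) ((v - variance_pmf X / 2) / (K + 1))"
  have \<mu>: "\<mu> \<ge> 0" by (simp add: \<mu>_def)
  have K: "K \<ge> 0" using \<eta> by (simp add: K_def integral_nonneg)
  have int: "integrable (measure_pmf X) real" "integrable (measure_pmf X) (\<lambda>j. real j ^ 2)"
    using integrable_power_if_exponential_moment[OF \<eta>, of 1] integrable_power_if_exponential_moment[OF \<eta>, of 2] by auto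
  have int2: "integrable (measure_pmf X) (\<lambda>j. (real j - \<mu>)\<^sup>2)"
    using int by (simp add: power2_diff)
  have "measure_pmf.expectation X (\<lambda>j. exp (\<theta> * real j)) \<le> exp (\<theta> * \<mu> + v * \<theta>\<^sup>2)"
    if \<theta>: "0 < \<theta>" "\<theta> \<le> \<delta>" for \<theta>
  proof -
    have \<theta>\<eta>: "\<theta> \<le> \<eta> / 2" and \<theta>v: "\<theta> * (K + 1) \<le> v - variance_pmf X / 2"
      using \<theta> K by (auto simp: \<delta>_def field_simps)
    \<comment> \<open>Half of the available rate \<open>\<eta>\<close> pays for the exponential in the remainder, the other half for the cube.\<close>
    have pt: "exp (\<theta> * (real j - \<mu>)) \<le> 1 + \<theta> * (real j - \<mu>) + \<theta>\<^sup>2 / 2 * (real j - \<mu>)\<^sup>2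
        + \<theta> ^ 3 * ((2 / \<eta>) ^ 3 * exp (\<eta> * \<mu>) * exp (\<eta> * real j))" for j
    proof -
      define y where "y = real j + \<mu>"
      have y: "y \<ge> 0" "\<bar>real j - \<mu>\<bar> \<le> y" using \<mu> by (auto simp: y_def)
      have a: "\<bar>\<theta> * (real j - \<mu>)\<bar> \<le> \<theta> * y" using y \<theta> by (auto simp: abs_mult)
      have b: "\<bar>\<theta> * (real j - \<mu>)\<bar> \<le> \<eta> / 2 * y"
        using a \<theta>\<eta> y by (meson mult_right_mono order_trans)
      have "\<bar>\<theta> * (real j - \<mu>)\<bar> ^ 3 * exp \<bar>\<theta> * (real j - \<mu>)\<bar> / 6 \<le> (\<theta> * y) ^ 3 * exp (\<eta> / 2 * y) / 6"
        using a b y \<theta> by (intro divide_right_mono mult_mono power_mono iffD2[OF exp_le_cancel_iff]) auto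
      also have "\<dots> = \<theta> ^ 3 * (y ^ 3 * exp (\<eta> / 2 * y) / 6)" by (simp add: power_mult_distrib)
      also have "\<dots> \<le> \<theta> ^ 3 * ((fact 3 / (\<eta> / 2) ^ 3 * exp (\<eta> / 2 * y)) * exp (\<eta> / 2 * y) / 6)"
        using power_le_fact_exp[of y "\<eta> / 2" 3] y \<eta> \<theta>
        by (intro mult_left_mono divide_right_mono mult_right_mono) auto
      also have "\<dots> = \<theta> ^ 3 * ((2 / \<eta>) ^ 3 * (exp (\<eta> / 2 * y) * exp (\<eta> / 2 * y)))"
        by (simp add: fact_numeral power_divide)
      also have "exp (\<eta> / 2 * y) * exp (\<eta> / 2 * y) = exp (\<eta> * \<mu>) * exp (\<eta> * real j)"
        by (simp add: exp_add[symmetric] y_def distrib_left)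
      finally show ?thesis
        using exp_le_cubic[of "\<theta> * (real j - \<mu>)"] by (simp add: power_mult_distrib mult_ac)
    qed
    have ie: "integrable (measure_pmf X) (\<lambda>j. exp (\<theta> * real j))"
      using integrable_exp_mono[OF \<eta>(2)] \<theta>\<eta> \<eta> by auto
    have ex: "exp (\<theta> * (real j - \<mu>)) = exp (- \<theta> * \<mu>) * exp (\<theta> * real j)" for j
      by (simp add: exp_add[symmetric] algebra_simps)
    have "exp (- \<theta> * \<mu>) * measure_pmf.expectation X (\<lambda>j. exp (\<theta> * real j)) =
        measure_pmf.expectation X (\<lambda>j. exp (\<theta> * (real j - \<mu>)))"
      unfolding ex by simp
    also have "\<dots> \<le> measure_pmf.expectation X (\<lambda>j. 1 + \<theta> * (real j - \<mu>) + \<theta>\<^sup>2 / 2 * (real j - \<mu>)\<^sup>2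
        + \<theta> ^ 3 * ((2 / \<eta>) ^ 3 * exp (\<eta> * \<mu>) * exp (\<eta> * real j)))"
    proof (rule integral_mono)
      show "integrable (measure_pmf X) (\<lambda>j. exp (\<theta> * (real j - \<mu>)))"
        unfolding ex using ie by simp
    qed (use pt int int2 \<eta> in auto)
    also have "\<dots> = 1 + \<theta>\<^sup>2 / 2 * variance_pmf X + \<theta> ^ 3 * K"
      using int int2 \<eta> by (simp add: K_def \<mu>_def[symmetric])
    also have "\<dots> = 1 + \<theta>\<^sup>2 * (variance_pmf X / 2 + \<theta> * K)"
      by (simp add: power2_eq_square power3_eq_cube algebra_simps)
    also have "\<dots> \<le> 1 + \<theta>\<^sup>2 * v"
      using \<theta>v \<theta> by (intro add_left_mono mult_left_mono) (auto simp: algebra_simps)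
    also have "\<dots> \<le> exp (v * \<theta>\<^sup>2)" using exp_ge_add_one_self[of "v * \<theta>\<^sup>2"] by (simp add: mult.commute)
    finally have "exp (- \<theta> * \<mu>) * measure_pmf.expectation X (\<lambda>j. exp (\<theta> * real j)) \<le> exp (v * \<theta>\<^sup>2)" .
    then have "exp (\<theta> * \<mu>) * (exp (- \<theta> * \<mu>) * measure_pmf.expectation X (\<lambda>j. exp (\<theta> * real j))) \<le>
      exp (\<theta> * \<mu>) * exp (v * \<theta>\<^sup>2)"
      by (intro mult_left_mono) auto
    then show ?thesis by (simp add: mult.assoc[symmetric] exp_add[symmetric])
  qed
  moreover have "\<delta> > 0" using \<eta> v K by (simp add: \<delta>_def)
  moreover have "integrable (measure_pmf X) (\<lambda>j. exp (\<theta> * real j))" if "0 < \<theta>" "\<theta> \<le> \<delta>" for \<theta>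
    using that \<eta> by (intro integrable_exp_mono[OF \<eta>(2)]) (auto simp: \<delta>_def)
  ultimately show ?thesis unfolding \<mu>_def by blast
qed

lemma set_demand_pmf_le:
  assumes "\<And>j. j \<in> set_pmf X \<Longrightarrow> real j \<le> \<mu>" and "a \<in> set_pmf (demand_pmf X n)"
  shows "real a \<le> real n * \<mu>"
  using assms(2)
proof (induction n arbitrary: a)
  case 0
  then show ?case by (simp add: demand_pmf_0)
next
  case (Suc n)
  then obtain j b where "a = j + b" "j \<in> set_pmf X" "b \<in> set_pmf (demand_pmf X n)"
    by (auto simp: demand_pmf_Suc)
  with Suc.IH[of b] assms(1)[of j] show ?case by (simp add: distrib_right)
qed

text \<open>
  If no value of \<open>X\<close> lay below the mean, \<open>X\<close> would be constant, and the demand could not exceed its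
  mean. This is how the possibility of overload rules out a degenerate \<open>X\<close>.
\<close>

lemma value_below_mean:
  assumes int: "integrable (measure_pmf X) real"
    and a: "a \<in> set_pmf (demand_pmf X n)" "real n * mean_pmf X < real a"
  shows "\<exists>j\<in>set_pmf X. real j < mean_pmf X"
proof (rule ccontr)
  assume "\<not> ?thesis"
  then have ge: "mean_pmf X \<le> real j" if "j \<in> set_pmf X" for j
    using that by force
  have "measure_pmf.expectation X (\<lambda>j. real j - mean_pmf X) = 0"
    using int by simp
  then have "AE j in measure_pmf X. real j - mean_pmf X = 0"
    using int ge by (subst (asm) integral_nonneg_eq_0_iff_AE) (auto simp: AE_measure_pmf_iff)
  then have "real j \<le> mean_pmf X" if "j \<in> set_pmf X" for j
    using that by (auto simp: AE_measure_pmf_iff)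
  from set_demand_pmf_le[OF this a(1)] a(2) show False by simp
qed

lemma variance_pmf_pos:
  assumes int: "integrable (measure_pmf X) real" "integrable (measure_pmf X) (\<lambda>j. real j ^ 2)"
    and j: "j \<in> set_pmf X" "real j < mean_pmf X"
  shows "variance_pmf X > 0"
proof (rule ccontr)
  assume "\<not> ?thesis"
  then have "variance_pmf X = 0"
    using measure_pmf.variance_positive[of X real] by linarith
  moreover have "integrable (measure_pmf X) (\<lambda>j. (real j - mean_pmf X)\<^sup>2)"
    using int by (simp add: power2_diff)
  ultimately have "AE j in measure_pmf X. (real j - mean_pmf X)\<^sup>2 = 0"
    by (subst (asm) integral_nonneg_eq_0_iff_AE) auto
  with j show False by (auto simp: AE_measure_pmf_iff)
qed

section \<open>Bounds for one system, uniform in its size\<close>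

lemma stationary_exp_bound:
  assumes stat: "stationary_pmf (congestion_kernel X n s) Q"
    and \<theta>: "\<theta> > 0" "integrable (measure_pmf X) (\<lambda>j. exp (\<theta> * real j))"
    and F: "exp (- \<theta> * real s) * measure_pmf.expectation X (\<lambda>j. exp (\<theta> * real j)) ^ n \<le> F" "F < 1"
  shows "integrable (measure_pmf Q) (\<lambda>q. exp (\<theta> * real q))"
    and "mean_pmf Q \<le> F / (\<theta> * (1 - F))"
proof -
  define F' where "F' = exp (- \<theta> * real s) * measure_pmf.expectation X (\<lambda>j. exp (\<theta> * real j)) ^ n"
  note D = expectation_exp_demand[OF \<theta>(2), of n]
  have F': "F' \<le> F" "F' < 1" using F by (auto simp: F'_def)
  note m = stationary_exp_moment[OF stat[unfolded stationary_congestion_iff] \<theta>(1) conjunct1[OF D],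
      of F', unfolded conjunct2[OF D], OF F'_def F'(2)]
  show int: "integrable (measure_pmf Q) (\<lambda>q. exp (\<theta> * real q))" by (rule m(1))
  have int1: "integrable (measure_pmf Q) real"
    using integrable_power_if_exponential_moment[OF \<theta>(1) int, of 1] by simp
  have "\<theta> * mean_pmf Q = measure_pmf.expectation Q (\<lambda>q. \<theta> * real q)" by simp
  also have "\<dots> \<le> measure_pmf.expectation Q (\<lambda>q. exp (\<theta> * real q) - 1)"
  proof (rule integral_mono)
    show "\<theta> * real q \<le> exp (\<theta> * real q) - 1" for q
      using exp_ge_add_one_self[of "\<theta> * real q"] by linarith
  qed (use int int1 in auto)
  also have "\<dots> \<le> 1 / (1 - F') - 1" using m(2) int by simp
  also have "\<dots> \<le> 1 / (1 - F) - 1" using F' F(2) by (simp add: frac_le)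
  also have "\<dots> = F / (1 - F)" using F(2) by (simp add: field_simps)
  finally have "mean_pmf Q \<le> F / (1 - F) / \<theta>"
    using \<theta>(1) by (subst pos_le_divide_eq) (auto simp: mult.commute)
  then show "mean_pmf Q \<le> F / (\<theta> * (1 - F))" by (simp add: mult.commute)
qed

text \<open>
  The exponent of \<open>E exp(\<theta> Y)\<close> is at most \<open>n v \<theta>\<^sup>2 - \<theta> d\<close>. Restricting to
  \<open>\<theta> \<le> d / (2 n v)\<close>, the minimiser, turns it into at most \<open>- n v \<theta>\<^sup>2\<close>, with a threshold \<open>\<delta>\<close> that
  depends on \<open>X\<close> and \<open>v\<close> only. This uniformity is what the asymptotic analysis uses.
\<close>

lemma mean_congestion_chernoff_bound:
  assumes \<eta>: "\<eta> > 0" "integrable (measure_pmf X) (\<lambda>j. exp (\<eta> * real j))"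
    and v: "variance_pmf X / 2 < v" "0 < v"
  shows "\<exists>\<delta>>0. \<forall>n s Q \<theta>. stationary_pmf (congestion_kernel X n s) Q \<and> 0 < \<theta> \<and> \<theta> \<le> \<delta> \<and>
      2 * real n * v * \<theta> \<le> real s - real n * mean_pmf X \<and> 0 < n \<longrightarrow>
     integrable (measure_pmf Q) (\<lambda>q. exp (\<theta> * real q)) \<and>
     mean_pmf Q \<le> exp (- real n * v * \<theta>\<^sup>2) / (\<theta> * (1 - exp (- real n * v * \<theta>\<^sup>2)))"
proof -
  obtain \<delta> where \<delta>: "\<delta> > 0" and bd: "\<And>\<theta>. 0 < \<theta> \<Longrightarrow> \<theta> \<le> \<delta> \<Longrightarrow> integrable (measure_pmf X) (\<lambda>j. exp (\<theta> * real j)) \<and>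
    measure_pmf.expectation X (\<lambda>j. exp (\<theta> * real j)) \<le> exp (\<theta> * mean_pmf X + v * \<theta>\<^sup>2)"
    using mgf_quadratic_bound[OF \<eta> v(1)] by blast
  have "integrable (measure_pmf Q) (\<lambda>q. exp (\<theta> * real q)) \<and>
     mean_pmf Q \<le> exp (- real n * v * \<theta>\<^sup>2) / (\<theta> * (1 - exp (- real n * v * \<theta>\<^sup>2)))"
    if stat: "stationary_pmf (congestion_kernel X n s) Q" and \<theta>: "0 < \<theta>" "\<theta> \<le> \<delta>"
     and d: "2 * real n * v * \<theta> \<le> real s - real n * mean_pmf X" and n: "0 < n" for n s Q \<theta>
  proof -
    let ?F = "exp (- real n * v * \<theta>\<^sup>2)"
    have "exp (- \<theta> * real s) * measure_pmf.expectation X (\<lambda>j. exp (\<theta> * real j)) ^ n \<le>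
       exp (- \<theta> * real s) * exp (\<theta> * mean_pmf X + v * \<theta>\<^sup>2) ^ n"
      using bd[OF \<theta>] by (intro mult_left_mono power_mono integral_nonneg) auto
    also have "\<dots> = exp (real n * v * \<theta>\<^sup>2 - \<theta> * (real s - real n * mean_pmf X))"
      by (simp add: exp_of_nat_mult[symmetric] exp_add[symmetric] algebra_simps)
    also have "\<dots> \<le> ?F"
      using mult_left_mono[OF d, of \<theta>] \<theta> by (simp add: power2_eq_square algebra_simps)
    finally have F: "exp (- \<theta> * real s) * measure_pmf.expectation X (\<lambda>j. exp (\<theta> * real j)) ^ n \<le> ?F" .
    have "?F < 1" using n v \<theta> by simp
    from stationary_exp_bound[OF stat \<theta>(1) _ F this] bd[OF \<theta>] show ?thesis by blast
  qed
  with \<delta> show ?thesis by blast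
qed

text \<open>
  Below capacity some exponential moment of \<open>Q\<close> is finite, so the first two moments exist and the
  stationary moment identities apply.
\<close>

lemma stationary_congestion_mean:
  assumes \<eta>: "\<eta> > 0" "integrable (measure_pmf X) (\<lambda>j. exp (\<eta> * real j))"
    and stat: "stationary_pmf (congestion_kernel X n s) Q"
    and load: "real n * mean_pmf X < real s" "0 < n"
  defines "U \<equiv> \<lambda>z. real (s - (fst z + snd z))"
  shows "integrable (measure_pmf Q) real"
    and "measure_pmf.expectation (pair_pmf Q (demand_pmf X n)) U = real s - real n * mean_pmf X"
    and "2 * (real s - real n * mean_pmf X) * mean_pmf Q =
         real n * variance_pmf X + (real s - real n * mean_pmf X)\<^sup>2
          - measure_pmf.expectation (pair_pmf Q (demand_pmf X n)) (\<lambda>z. U z ^ 2)"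
proof -
  define v where "v = variance_pmf X / 2 + 1"
  have v: "variance_pmf X / 2 < v" "0 < v"
    using measure_pmf.variance_positive[of X real] unfolding v_def by linarith+
  obtain \<delta> where \<delta>: "\<delta> > 0" and bd: "\<And>\<theta>. 0 < \<theta> \<Longrightarrow> \<theta> \<le> \<delta> \<Longrightarrow>
      2 * real n * v * \<theta> \<le> real s - real n * mean_pmf X \<Longrightarrow>
     integrable (measure_pmf Q) (\<lambda>q. exp (\<theta> * real q))"
    using mean_congestion_chernoff_bound[OF \<eta> v] stat load by blast
  define \<theta> where "\<theta> = min \<delta> ((real s - real n * mean_pmf X) / (2 * real n * v))"
  have \<theta>: "\<theta> > 0" using \<delta> load v by (simp add: \<theta>_def)
  have "\<theta> \<le> (real s - real n * mean_pmf X) / (2 * real n * v)" by (simp add: \<theta>_def)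
  then have "2 * real n * v * \<theta> \<le> real s - real n * mean_pmf X"
    using load v by (simp add: pos_le_divide_eq mult.commute)
  then have iQ: "integrable (measure_pmf Q) (\<lambda>q. exp (\<theta> * real q))"
    using \<theta> by (intro bd) (auto simp: \<theta>_def)
  have Q: "integrable (measure_pmf Q) real" "integrable (measure_pmf Q) (\<lambda>q. real q ^ 2)"
    using integrable_power_if_exponential_moment[OF \<theta> iQ, of 1]
      integrable_power_if_exponential_moment[OF \<theta> iQ, of 2] by auto
  have X: "integrable (measure_pmf X) real" "integrable (measure_pmf X) (\<lambda>j. real j ^ 2)"
    using integrable_power_if_exponential_moment[OF \<eta>, of 1]
      integrable_power_if_exponential_moment[OF \<eta>, of 2] by auto
  have D: "integrable (measure_pmf (demand_pmf X n)) real"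
    "integrable (measure_pmf (demand_pmf X n)) (\<lambda>a. real a ^ 2)"
    "mean_pmf (demand_pmf X n) = real n * mean_pmf X"
    "measure_pmf.expectation (demand_pmf X n) (\<lambda>a. real a ^ 2) = real n * variance_pmf X + (real n * mean_pmf X)\<^sup>2"
    using demand_moments[OF X, of n] by auto
  note f = stationary_mean_formula[OF stat[unfolded stationary_congestion_iff] D(1,2) Q, unfolded D(3,4)]
  show "integrable (measure_pmf Q) real" by fact
  show "measure_pmf.expectation (pair_pmf Q (demand_pmf X n)) U = real s - real n * mean_pmf X"
    unfolding U_def by (rule f(1))
  show "2 * (real s - real n * mean_pmf X) * mean_pmf Q =
         real n * variance_pmf X + (real s - real n * mean_pmf X)\<^sup>2
          - measure_pmf.expectation (pair_pmf Q (demand_pmf X n)) (\<lambda>z. U z ^ 2)"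
    unfolding U_def f(2) by (simp add: power2_diff)
qed

text \<open>
  The scale \<open>t = 1 / sqrt s\<close> matches the fluctuations of the demand: there \<open>n t\<^sup>2\<close> is bounded above and
  below, and \<open>t d \<le> G\<close>. Hence \<open>M(2 t)\<close> is bounded above by the upper Laplace bound, and \<open>M(t)\<close> is bounded
  away from zero by the lower one with Bernoulli's inequality.
\<close>

lemma heavy_traffic_idle_second_moment:
  assumes X: "integrable (measure_pmf X) real" "integrable (measure_pmf X) (\<lambda>j. real j ^ 2)"
    and j0: "j0 \<in> set_pmf X" "real j0 < mean_pmf X"
  shows "\<exists>K>0. \<forall>n s Q. stationary_pmf (congestion_kernel X n s) Q \<and> 0 < s \<and> real s / 2 \<le> real n * mean_pmf X \<and>
      real n * mean_pmf X \<le> real s \<and> real s - real n * mean_pmf X \<le> G * sqrt (real s) \<longrightarrow>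
     measure_pmf.expectation (pair_pmf Q (demand_pmf X n)) (\<lambda>z. real (s - (fst z + snd z)) ^ 2) \<le>
     K * sqrt (real s) * measure_pmf.expectation (pair_pmf Q (demand_pmf X n)) (\<lambda>z. real (s - (fst z + snd z)))"
proof -
  define \<mu> where "\<mu> = mean_pmf X"
  define m2 where "m2 = measure_pmf.expectation X (\<lambda>j. real j ^ 2)"
  define c where "c = pmf X j0 * (\<mu> - real j0)\<^sup>2 / 2"
  define B where "B = exp (2 * G + 2 * m2 / \<mu>) / (c / (2 * \<mu>))"
  have \<mu>: "\<mu> > 0" using j0 unfolding \<mu>_def by (meson le_less_trans of_nat_0_le_iff)
  have m2: "m2 \<ge> 0" by (simp add: m2_def)
  have c: "c > 0" using j0 by (simp add: c_def \<mu>_def pmf_positive)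
  have B: "B > 0" using \<mu> c by (simp add: B_def)
  have "measure_pmf.expectation (pair_pmf Q (demand_pmf X n)) (\<lambda>z. real (s - (fst z + snd z)) ^ 2) \<le>
     8 * B * sqrt (real s) * measure_pmf.expectation (pair_pmf Q (demand_pmf X n)) (\<lambda>z. real (s - (fst z + snd z)))"
    if stat: "stationary_pmf (congestion_kernel X n s) Q" and s: "0 < s"
      and half: "real s / 2 \<le> real n * \<mu>" and le: "real n * \<mu> \<le> real s"
      and d: "real s - real n * \<mu> \<le> G * sqrt (real s)" for n s Q
  proof -
    define t where "t = 1 / sqrt (real s)"
    define M where "M t = exp (t * real s) * measure_pmf.expectation (demand_pmf X n) (\<lambda>a. exp (- t * real a)) - 1" for t
    have t: "t > 0" "t\<^sup>2 = 1 / real s" using s by (auto simp: t_def power_divide)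
    have n: "0 < real n" using half s \<mu> by (cases n) auto
    have M_eq: "M u = exp (u * real s) * measure_pmf.expectation X (\<lambda>j. exp (- u * real j)) ^ n - 1" if "u \<ge> 0" for u
    proof -
      have "integrable (measure_pmf X) (\<lambda>j. exp ((- u) * real j))"
        by (rule integrable_pmf_bounded[where B=1]) (use that in auto)
      from expectation_exp_demand[OF this, of n] show ?thesis by (simp add: M_def)
    qed
    have "c / (2 * \<mu>) \<le> c * (real n / real s)"
      using half s \<mu> c by (simp add: field_simps)
    also have "\<dots> = real n * (c * t\<^sup>2)" by (simp add: t)
    also have "\<dots> \<le> (1 + c * t\<^sup>2) ^ n - 1"
      using Bernoulli_inequality[of "c * t\<^sup>2" n] c by (simp add: order_trans[of _ 0])
    also have "\<dots> \<le> exp (t * (real s - real n * \<mu>)) * (1 + c * t\<^sup>2) ^ n - 1"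
    proof -
      have "1 * (1 + c * t\<^sup>2) ^ n \<le> exp (t * (real s - real n * \<mu>)) * (1 + c * t\<^sup>2) ^ n"
        using t le c by (intro mult_right_mono) auto
      then show ?thesis by simp
    qed
    also have "exp (t * (real s - real n * \<mu>)) * (1 + c * t\<^sup>2) ^ n =
        exp (t * real s) * (exp (- t * \<mu>) * (1 + c * t\<^sup>2)) ^ n"
    proof -
      have "t * (real s - real n * \<mu>) = t * real s + real n * (- t * \<mu>)" by (simp add: algebra_simps)
      then show ?thesis by (simp only: power_mult_distrib exp_of_nat_mult exp_add mult.assoc)
    qed
    also have "exp (t * real s) * (exp (- t * \<mu>) * (1 + c * t\<^sup>2)) ^ n - 1 \<le> M t"
      unfolding M_eq[OF less_imp_le[OF t(1)]]
      using laplace_lower_bound[OF X(1) less_imp_le[OF j0(2)] less_imp_le[OF t(1)]] c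
      by (intro diff_right_mono mult_left_mono power_mono) (auto simp: c_def \<mu>_def)
    finally have lower: "c / (2 * \<mu>) \<le> M t" .
    have "M (2 * t) \<le> exp (2 * t * real s) * measure_pmf.expectation X (\<lambda>j. exp (- (2 * t) * real j)) ^ n"
      using t by (simp add: M_eq)
    also have "\<dots> \<le> exp (2 * t * real s) * exp (- (2 * t) * \<mu> + (2 * t)\<^sup>2 * m2 / 2) ^ n"
      using laplace_upper_bound[OF X, of "2 * t"] t
      by (intro mult_left_mono power_mono integral_nonneg) (auto simp: \<mu>_def m2_def)
    also have "\<dots> = exp (2 * (t * (real s - real n * \<mu>)) + 2 * m2 * (real n * t\<^sup>2))"
      by (simp add: exp_of_nat_mult[symmetric] exp_add[symmetric] algebra_simps power_mult_distrib)
    also have "\<dots> \<le> exp (2 * G + 2 * m2 / \<mu>)"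
    proof -
      have "t * (real s - real n * \<mu>) \<le> G" using d s by (simp add: t_def field_simps)
      moreover have "m2 * (real n * t\<^sup>2) \<le> m2 * (1 / \<mu>)"
        using le s \<mu> m2 by (intro mult_left_mono) (auto simp: t field_simps)
      ultimately show ?thesis by simp
    qed
    also have "\<dots> = B * (c / (2 * \<mu>))" using \<mu> c by (simp add: B_def)
    also have "\<dots> \<le> B * M t" using lower B by (intro mult_left_mono) auto
    finally have upper: "M (2 * t) \<le> B * M t" .
    have "M t > 0" using lower c \<mu> by (meson divide_pos_pos less_le_trans mult_pos_pos zero_less_numeral)
    from stationary_idle_second_moment[OF stat[unfolded stationary_congestion_iff] t(1)
        this[unfolded M_def] upper[unfolded M_def] B]
    show ?thesis by (simp add: t_def)
  qed
  then show ?thesis using B unfolding \<mu>_def[symmetric] by (intro exI[of _ "8 * B"]) simp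
qed

section \<open>Asymptotics of the mean congestion level\<close>

lemma exp_neg_powr_tendsto_0:
  fixes a \<beta> :: real
  assumes "a > 0" "\<beta> > 0"
  shows "((\<lambda>x. exp (- a * x powr \<beta>)) \<longlongrightarrow> 0) at_top"
  using assms by real_asymp

lemma powr_times_exp_neg_powr_tendsto_0:
  fixes a \<beta> \<alpha> :: real
  assumes "a > 0" "\<beta> > 0" "\<alpha> > 0"
  shows "((\<lambda>x. x powr \<alpha> * exp (- a * x powr \<beta>)) \<longlongrightarrow> 0) at_top"
  using assms by real_asymp

theorem proposition4:
  fixes X :: "nat pmf"
    and s n :: "nat \<Rightarrow> nat"
    and \<gamma> :: "nat \<Rightarrow> real"
    and Q :: "nat \<Rightarrow> nat pmf"
    and \<alpha> c C :: real
  assumes mean_pos: "mean_pmf X > 0"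
    and radius: "pgf_radius X > 1"
    and pgf_max: "\<And>r z. 0 < r \<Longrightarrow> ereal r < pgf_radius X \<Longrightarrow> norm (z :: complex) = r \<Longrightarrow>
                    z \<noteq> of_real r \<Longrightarrow> norm (pgf X z) < pgf X r"
    and s_lim: "filterlim s at_top sequentially"
    and load: "\<And>k. 0 < real (n k) * mean_pmf X" "\<And>k. real (n k) * mean_pmf X < real (s k)"
    and overload: "\<And>k. \<exists>j > s k. pmf (demand_pmf X (n k)) j > 0"
    and \<alpha>_pos: "\<alpha> > 0"
    and \<gamma>_pos: "\<And>k. \<gamma> k > 0"
    and \<gamma>_bounds: "c > 0" "\<forall>\<^sub>F k in sequentially. c \<le> \<gamma> k \<and> \<gamma> k \<le> C"
    and scaling: "\<And>k. real (n k) * mean_pmf X / real (s k) = 1 - \<gamma> k / real (s k) powr \<alpha>"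
    and stationary: "\<And>k. stationary_pmf (congestion_kernel X (n k) (s k)) (Q k)"
  shows "(\<forall>k. integrable (measure_pmf (Q k)) real) \<and>
    (\<alpha> < 1/2 \<longrightarrow>
      (\<forall>b > 0. ereal b < liminf (\<lambda>k. ereal (sqrt ((\<gamma> k)\<^sup>2 * mean_pmf X / (2 * variance_pmf X)))) \<longrightarrow>
        (\<lambda>k. mean_pmf (Q k)) \<in> O(\<lambda>k. exp (- b\<^sup>2 * real (s k) powr (1 - 2 * \<alpha>))))) \<and>
    (\<alpha> \<ge> 1/2 \<longrightarrow>
      (\<exists>\<epsilon> \<in> O(\<lambda>k. real (s k) powr max (1/2 - \<alpha>) (-1)).
        \<forall>k. mean_pmf (Q k) =
          real (s k) powr \<alpha> * (variance_pmf X / (2 * mean_pmf X * \<gamma> k)) * (1 + \<epsilon> k)))"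
proof -
  define \<mu> where "\<mu> = mean_pmf X"
  define \<sigma>2 where "\<sigma>2 = variance_pmf X"
  define d where "d k = real (s k) - real (n k) * \<mu>" for k
  have \<mu>: "\<mu> > 0" using mean_pos by (simp add: \<mu>_def)
  have s_pos: "0 < real (s k)" and n_pos: "0 < n k" and d_pos: "0 < d k" for k
    using load(1)[of k] load(2)[of k] less_trans[OF load(1) load(2), of k] mean_pos
    by (simp_all add: d_def \<mu>_def zero_less_mult_iff)
  have d_eq: "d k = \<gamma> k * real (s k) powr (1 - \<alpha>)" for k
  proof -
    have "d k = real (s k) * (1 - real (n k) * \<mu> / real (s k))"
      using s_pos[of k] by (simp add: d_def field_simps)
    also have "\<dots> = real (s k) * (\<gamma> k / real (s k) powr \<alpha>)"
      using scaling[of k] by (simp add: \<mu>_def)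
    finally show ?thesis using s_pos[of k] by (simp add: powr_diff)
  qed
  obtain \<eta> where \<eta>: "\<eta> > 0" "integrable (measure_pmf X) (\<lambda>j. exp (\<eta> * real j))"
    using exponential_moment_if_pgf_radius_gt_1[OF radius] by blast
  have X: "integrable (measure_pmf X) real" "integrable (measure_pmf X) (\<lambda>j. real j ^ 2)"
    using integrable_power_if_exponential_moment[OF \<eta>, of 1]
      integrable_power_if_exponential_moment[OF \<eta>, of 2] by auto
  obtain a where a: "a > s 0" "a \<in> set_pmf (demand_pmf X (n 0))"
    using overload[of 0] by (auto simp: set_pmf_iff)
  obtain j0 where j0: "j0 \<in> set_pmf X" "real j0 < mean_pmf X"
    using value_below_mean[OF X(1) a(2)] a(1) load(2)[of 0] by force
  have \<sigma>2: "\<sigma>2 > 0" using variance_pmf_pos[OF X j0] by (simp add: \<sigma>2_def)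
  have mean: "integrable (measure_pmf (Q k)) real"
    "measure_pmf.expectation (pair_pmf (Q k) (demand_pmf X (n k))) (\<lambda>z. real (s k - (fst z + snd z))) = d k"
    "2 * d k * mean_pmf (Q k) = real (n k) * \<sigma>2 + (d k)\<^sup>2 -
      measure_pmf.expectation (pair_pmf (Q k) (demand_pmf X (n k))) (\<lambda>z. real (s k - (fst z + snd z)) ^ 2)" for k
    using stationary_congestion_mean[OF \<eta> stationary load(2)[of k] n_pos]
    unfolding d_def \<mu>_def \<sigma>2_def by auto
  have sr: "filterlim (\<lambda>k. real (s k)) at_top sequentially"
    using filterlim_compose[OF filterlim_real_sequentially s_lim] by simp
  have C: "C > 0" using eventually_happens[OF \<gamma>_bounds(2)] \<gamma>_bounds(1) by auto
  have "((\<lambda>x::real. C * x powr (- \<alpha>)) \<longlongrightarrow> 0) at_top"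
    using \<alpha>_pos by real_asymp
  \<comment> \<open>Eventually the load is at least one half, which makes \<open>n\<close> and \<open>s\<close> comparable.\<close>
  then have "\<forall>\<^sub>F k in sequentially. C * real (s k) powr (- \<alpha>) < 1 / 2"
    by (intro order_tendstoD[OF filterlim_compose[OF _ sr]]) auto
  moreover have "\<forall>\<^sub>F k in sequentially. real (s k) \<ge> 1"
    using sr unfolding filterlim_at_top by blast
  ultimately have ev: "\<forall>\<^sub>F k in sequentially. c \<le> \<gamma> k \<and> \<gamma> k \<le> C \<and> 1 \<le> real (s k) \<and> real (s k) / 2 \<le> real (n k) * \<mu>"
    using \<gamma>_bounds(2)
  proof eventually_elim
    case (elim k)
    have "d k = real (s k) * (\<gamma> k * real (s k) powr (- \<alpha>))"
      using s_pos[of k] by (simp add: d_eq powr_diff powr_minus field_simps)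
    also have "\<dots> \<le> real (s k) * (C * real (s k) powr (- \<alpha>))"
      using elim by (intro mult_left_mono mult_right_mono) auto
    also have "\<dots> \<le> real (s k) * (1 / 2)"
      using elim by (intro mult_left_mono) auto
    finally show ?case using elim by (simp add: d_def)
  qed

  have light: "(\<lambda>k. mean_pmf (Q k)) \<in> O(\<lambda>k. exp (- b\<^sup>2 * real (s k) powr (1 - 2 * \<alpha>)))"
    if \<alpha>: "\<alpha> < 1 / 2" and b: "b > 0"
      "ereal b < liminf (\<lambda>k. ereal (sqrt ((\<gamma> k)\<^sup>2 * mean_pmf X / (2 * variance_pmf X))))" for b
  proof -
    obtain b' where b': "ereal b < ereal b'" and
      lim: "ereal b' < liminf (\<lambda>k. ereal (sqrt ((\<gamma> k)\<^sup>2 * mean_pmf X / (2 * variance_pmf X))))"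
      using ereal_dense2[OF b(2)] by blast
    then have bb': "b < b'" by simp
    \<comment> \<open>With this \<open>v\<close> the exponent becomes \<open>b b'\<close>, strictly between \<open>b\<^sup>2\<close> and \<open>b'\<^sup>2\<close>: passing from
      \<open>b'\<close> to \<open>b\<close> pays once for \<open>v > \<sigma>\<^sup>2 / 2\<close> and once for the polynomial factor.\<close>
    define v where "v = \<sigma>2 * b' / (2 * b)"
    define S where "S k = real (s k) powr (1 - 2 * \<alpha>)" for k
    have v: "variance_pmf X / 2 < v" "0 < v"
      using bb' b \<sigma>2 by (auto simp: v_def \<sigma>2_def[symmetric] field_simps)
    obtain \<delta> where \<delta>: "\<delta> > 0" and bd: "\<And>n s Q \<theta>. stationary_pmf (congestion_kernel X n s) Q \<Longrightarrow> 0 < \<theta> \<Longrightarrow> \<theta> \<le> \<delta> \<Longrightarrow>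
      2 * real n * v * \<theta> \<le> real s - real n * mean_pmf X \<Longrightarrow> 0 < n \<Longrightarrow>
       mean_pmf Q \<le> exp (- real n * v * \<theta>\<^sup>2) / (\<theta> * (1 - exp (- real n * v * \<theta>\<^sup>2)))"
      using mean_congestion_chernoff_bound[OF \<eta> v] by blast
    have "((\<lambda>x::real. C * \<mu> / v * x powr (- \<alpha>)) \<longlongrightarrow> 0) at_top"
      using \<alpha>_pos by real_asymp
    then have ev1: "\<forall>\<^sub>F k in sequentially. C * \<mu> / v * real (s k) powr (- \<alpha>) < \<delta>"
      using \<delta> by (intro order_tendstoD[OF filterlim_compose[OF _ sr]]) auto
    have bb: "b * b' > 0" "b * b' - b\<^sup>2 > 0" "1 - 2 * \<alpha> > 0"
      using b bb' \<alpha> by (auto simp: power2_eq_square)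
    have "((\<lambda>x::real. exp (- (b * b') * x powr (1 - 2 * \<alpha>))) \<longlongrightarrow> 0) at_top"
      by (rule exp_neg_powr_tendsto_0) (use bb in auto)
    then have ev2: "\<forall>\<^sub>F k in sequentially. exp (- (b * b') * S k) < 1 / 2"
      unfolding S_def by (intro order_tendstoD[OF filterlim_compose[OF _ sr]]) auto
    have "((\<lambda>x::real. x powr \<alpha> * exp (- (b * b' - b\<^sup>2) * x powr (1 - 2 * \<alpha>))) \<longlongrightarrow> 0) at_top"
      by (rule powr_times_exp_neg_powr_tendsto_0) (use bb \<alpha>_pos in auto)
    then have ev3: "\<forall>\<^sub>F k in sequentially. real (s k) powr \<alpha> * exp (- (b * b' - b\<^sup>2) * S k) < 1"
      unfolding S_def by (intro order_tendstoD[OF filterlim_compose[OF _ sr]]) auto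
    have "\<forall>\<^sub>F k in sequentially. norm (mean_pmf (Q k)) \<le> (4 * v / (\<mu> * c)) * norm (exp (- b\<^sup>2 * S k))"
      using ev ev1 ev2 ev3 less_LiminfD[OF lim]
    proof eventually_elim
      case (elim k)
      define x where "x = real (s k)"
      define \<theta> where "\<theta> = d k / (2 * real (n k) * v)"
      have x: "x \<ge> 1" using elim by (simp add: x_def)
      have n: "0 < real (n k)" "real (n k) * \<mu> \<le> x" "x / 2 \<le> real (n k) * \<mu>"
        using n_pos[of k] load(2)[of k] elim by (auto simp: x_def \<mu>_def)
      have \<theta>0: "\<theta> > 0" using d_pos[of k] n v by (simp add: \<theta>_def)
      have dx: "d k = \<gamma> k * (x * x powr (- \<alpha>))"
        using x by (simp add: d_eq x_def[symmetric] powr_diff powr_minus field_simps)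
      have "\<theta> = \<gamma> k * (x * x powr (- \<alpha>)) * \<mu> / (2 * (real (n k) * \<mu>) * v)"
        using \<mu> by (simp add: \<theta>_def dx)
      also have "\<dots> \<le> C * (x * x powr (- \<alpha>)) * \<mu> / (2 * (x / 2) * v)"
        using elim x n \<mu> v C by (intro frac_le mult_right_mono mult_left_mono mult_nonneg_nonneg mult_pos_pos) auto
      also have "\<dots> = C * \<mu> / v * x powr (- \<alpha>)" using x by simp
      finally have \<theta>\<delta>: "\<theta> \<le> \<delta>" using elim by (simp add: x_def)
      have "1 / \<theta> = 2 * (real (n k) * \<mu>) * v / (\<mu> * (\<gamma> k * (x * x powr (- \<alpha>))))"
        using \<mu> by (simp add: \<theta>_def dx)
      also have "\<dots> \<le> 2 * x * v / (\<mu> * (c * (x * x powr (- \<alpha>))))"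
        using elim x n \<mu> v \<gamma>_bounds(1)
        by (intro frac_le mult_right_mono mult_left_mono mult_nonneg_nonneg mult_pos_pos) auto
      also have "\<dots> = 2 * v / (\<mu> * c) * x powr \<alpha>" using x by (simp add: powr_minus field_simps)
      finally have inv\<theta>: "1 / \<theta> \<le> 2 * v / (\<mu> * c) * x powr \<alpha>" .
      have "b' < sqrt ((\<gamma> k)\<^sup>2 * \<mu> / (2 * \<sigma>2))" using elim by (simp add: \<mu>_def \<sigma>2_def)
      then have "b'\<^sup>2 < (sqrt ((\<gamma> k)\<^sup>2 * \<mu> / (2 * \<sigma>2)))\<^sup>2"
        using b bb' by (intro power_strict_mono) auto
      then have "b'\<^sup>2 < (\<gamma> k)\<^sup>2 * \<mu> / (2 * \<sigma>2)" using \<mu> \<sigma>2 by simp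
      then have "b * b' \<le> (\<gamma> k)\<^sup>2 * \<mu> / (4 * v)"
        using b bb' \<sigma>2 by (simp add: v_def field_simps power2_eq_square)
      moreover have Sx: "S k = x * (x powr (- \<alpha>))\<^sup>2"
        using x by (simp add: S_def x_def[symmetric] powr_diff powr_minus power2_eq_square
            powr_add[symmetric] mult_2 field_simps)
      ultimately have "b * b' * S k \<le> (\<gamma> k)\<^sup>2 * \<mu> / (4 * v) * S k"
        using x by (intro mult_right_mono) auto
      also have "(\<gamma> k)\<^sup>2 * \<mu> / (4 * v) * S k = (d k)\<^sup>2 / (4 * (x / \<mu>) * v)"
        using x \<mu> by (simp add: Sx dx power2_eq_square field_simps)
      also have "\<dots> \<le> (d k)\<^sup>2 / (4 * real (n k) * v)"
        using n \<mu> v x by (intro divide_left_mono mult_right_mono mult_left_mono mult_pos_pos)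
           (auto simp: field_simps)
      also have "\<dots> = real (n k) * v * \<theta>\<^sup>2"
        using n v by (simp add: \<theta>_def power2_eq_square field_simps)
      finally have F: "exp (- real (n k) * v * \<theta>\<^sup>2) \<le> exp (- (b * b') * S k)" by simp
      have "mean_pmf (Q k) \<le> exp (- real (n k) * v * \<theta>\<^sup>2) / (\<theta> * (1 - exp (- real (n k) * v * \<theta>\<^sup>2)))"
        using n v by (intro bd[OF stationary \<theta>0 \<theta>\<delta> _ n_pos]) (simp add: \<theta>_def d_def \<mu>_def)
      also have "\<dots> \<le> exp (- (b * b') * S k) / (\<theta> * (1 / 2))"
      proof -
        have "exp (- real (n k) * v * \<theta>\<^sup>2) \<le> 1 / 2" using F elim by linarith
        then show ?thesis using F \<theta>0 by (intro frac_le mult_left_mono) auto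
      qed
      also have "\<dots> = 2 * exp (- (b * b') * S k) * (1 / \<theta>)" by simp
      also have "\<dots> \<le> 2 * exp (- (b * b') * S k) * (2 * v / (\<mu> * c) * x powr \<alpha>)"
        by (intro mult_left_mono inv\<theta>) auto
      also have "\<dots> = 4 * v / (\<mu> * c) * (x powr \<alpha> * exp (- (b * b' - b\<^sup>2) * S k)) * exp (- b\<^sup>2 * S k)"
        by (simp add: exp_add[symmetric] algebra_simps)
      also have "\<dots> \<le> 4 * v / (\<mu> * c) * 1 * exp (- b\<^sup>2 * S k)"
        using elim(4) v \<mu> \<gamma>_bounds(1) by (intro mult_right_mono mult_left_mono) (auto simp: x_def)
      finally show ?case by (simp add: abs_of_nonneg[OF integral_nonneg])
    qed
    then show ?thesis unfolding S_def by (rule bigoI)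
  qed

  have heavy: "\<exists>\<epsilon> \<in> O(\<lambda>k. real (s k) powr max (1/2 - \<alpha>) (-1)).
        \<forall>k. mean_pmf (Q k) =
          real (s k) powr \<alpha> * (variance_pmf X / (2 * mean_pmf X * \<gamma> k)) * (1 + \<epsilon> k)"
    if \<alpha>: "\<alpha> \<ge> 1 / 2"
  proof -
    define V where "V k = measure_pmf.expectation (pair_pmf (Q k) (demand_pmf X (n k)))
       (\<lambda>z. real (s k - (fst z + snd z)) ^ 2)" for k
    define \<epsilon> where "\<epsilon> k = - \<gamma> k * real (s k) powr (- \<alpha>) + ((d k)\<^sup>2 - V k) * \<mu> / (real (s k) * \<sigma>2)" for k
    obtain K where K: "K > 0" and V_le: "\<And>n s Q. stationary_pmf (congestion_kernel X n s) Q \<Longrightarrow> 0 < s \<Longrightarrow>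
      real s / 2 \<le> real n * mean_pmf X \<Longrightarrow> real n * mean_pmf X \<le> real s \<Longrightarrow>
      real s - real n * mean_pmf X \<le> C * sqrt (real s) \<Longrightarrow>
     measure_pmf.expectation (pair_pmf Q (demand_pmf X n)) (\<lambda>z. real (s - (fst z + snd z)) ^ 2) \<le>
     K * sqrt (real s) * measure_pmf.expectation (pair_pmf Q (demand_pmf X n)) (\<lambda>z. real (s - (fst z + snd z)))"
      using heavy_traffic_idle_second_moment[OF X j0, of C] by blast
    \<comment> \<open>The function \<open>\<epsilon>\<close> is forced: it is the exact relative error in the mean formula.\<close>
    have "mean_pmf (Q k) = real (s k) powr \<alpha> * (\<sigma>2 / (2 * \<mu> * \<gamma> k)) * (1 + \<epsilon> k)" for k
    proof -
      have load_eq: "real (n k) = real (s k) * (1 - \<gamma> k * real (s k) powr (- \<alpha>)) / \<mu>"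
        using scaling[of k] s_pos[of k] \<mu> by (simp add: \<mu>_def powr_minus field_simps)
      have "1 + \<epsilon> k = (real (n k) * \<sigma>2 + (d k)\<^sup>2 - V k) * \<mu> / (real (s k) * \<sigma>2)"
        using s_pos[of k] \<mu> \<sigma>2 by (simp add: \<epsilon>_def load_eq field_simps)
      also have "real (n k) * \<sigma>2 + (d k)\<^sup>2 - V k = 2 * d k * mean_pmf (Q k)"
        using mean(3)[of k] by (simp add: V_def)
      finally have "1 + \<epsilon> k = 2 * d k * mean_pmf (Q k) * \<mu> / (real (s k) * \<sigma>2)" .
      then show ?thesis
        using s_pos[of k] \<mu> \<sigma>2 \<gamma>_pos[of k] by (simp add: d_eq powr_diff field_simps)
    qed
    moreover have "\<epsilon> \<in> O(\<lambda>k. real (s k) powr max (1/2 - \<alpha>) (-1))"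
    proof (rule bigoI)
      show "\<forall>\<^sub>F k in sequentially. norm (\<epsilon> k) \<le>
        (C + (C\<^sup>2 + K * C) * \<mu> / \<sigma>2) * norm (real (s k) powr max (1/2 - \<alpha>) (-1))"
        using ev
      proof eventually_elim
        case (elim k)
        define x where "x = real (s k)"
        \<comment> \<open>In terms of \<open>p\<close> the deficit is \<open>d = \<gamma> sqrt x p\<close>, and \<open>p \<le> 1\<close> because \<open>\<alpha> \<ge> 1 / 2\<close>.\<close>
        define p where "p = x powr (1 / 2 - \<alpha>)"
        have x: "x \<ge> 1" using elim by (simp add: x_def)
        have p: "0 \<le> p" "p \<le> 1" using x \<alpha> powr_mono[of "1 / 2 - \<alpha>" 0 x] by (auto simp: p_def)
        have dx: "d k = \<gamma> k * (sqrt x * p)"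
          using x by (simp add: d_eq x_def[symmetric] p_def powr_half_sqrt[symmetric] powr_add[symmetric])
        have g: "0 < \<gamma> k" "\<gamma> k \<le> C" using \<gamma>_pos elim by auto
        have "d k \<le> C * (sqrt x * 1)"
          unfolding dx using g p x C by (intro mult_mono) auto
        then have "V k \<le> K * sqrt x * d k"
          using V_le[OF stationary, of k] elim load(2)[of k] mean(2)[of k]
          unfolding V_def x_def d_def \<mu>_def by simp
        also have "\<dots> = K * \<gamma> k * p * x" using x by (simp add: dx)
        also have "\<dots> \<le> K * C * p * x" using g K p x by (intro mult_right_mono mult_left_mono) auto
        finally have V: "V k \<le> K * C * p * x" .
        have V0: "0 \<le> V k" by (simp add: V_def)
        have "(d k)\<^sup>2 = (\<gamma> k)\<^sup>2 * (p * p) * x"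
          using x by (simp add: dx power_mult_distrib) (simp add: power2_eq_square)
        also have "\<dots> \<le> C\<^sup>2 * (p * 1) * x"
          using g p x by (intro mult_right_mono mult_mono power_mono) auto
        finally have d2: "(d k)\<^sup>2 \<le> C\<^sup>2 * p * x" by simp
        have "\<bar>(d k)\<^sup>2 - V k\<bar> \<le> C\<^sup>2 * p * x + K * C * p * x"
          using V V0 d2 by (simp add: abs_le_iff) (smt (verit) zero_le_power2)
        also have "\<dots> = (C\<^sup>2 + K * C) * p * x" by (simp add: algebra_simps)
        finally have "\<bar>(d k)\<^sup>2 - V k\<bar> * \<mu> / (x * \<sigma>2) \<le> (C\<^sup>2 + K * C) * p * x * \<mu> / (x * \<sigma>2)"
          using \<mu> \<sigma>2 x by (intro divide_right_mono mult_right_mono) auto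
        also have "\<dots> = (C\<^sup>2 + K * C) * \<mu> / \<sigma>2 * p" using x by simp
        finally have A: "\<bar>(d k)\<^sup>2 - V k\<bar> * \<mu> / (x * \<sigma>2) \<le> (C\<^sup>2 + K * C) * \<mu> / \<sigma>2 * p" .
        have B: "\<gamma> k * x powr (- \<alpha>) \<le> C * p"
          unfolding p_def using g x C by (intro mult_mono powr_mono) auto
        have "norm (\<epsilon> k) \<le> \<bar>\<gamma> k * x powr (- \<alpha>)\<bar> + \<bar>((d k)\<^sup>2 - V k) * \<mu> / (x * \<sigma>2)\<bar>"
          using abs_triangle_ineq[of "- \<gamma> k * x powr (- \<alpha>)" "((d k)\<^sup>2 - V k) * \<mu> / (x * \<sigma>2)"]
          by (simp only: \<epsilon>_def x_def real_norm_def mult_minus_left abs_minus_cancel)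
        also have "\<dots> = \<gamma> k * x powr (- \<alpha>) + \<bar>(d k)\<^sup>2 - V k\<bar> * \<mu> / (x * \<sigma>2)"
          using g \<mu> \<sigma>2 x by (simp add: abs_mult)
        also have "\<dots> \<le> (C + (C\<^sup>2 + K * C) * \<mu> / \<sigma>2) * p"
          using A B by (simp add: distrib_right)
        also have "\<dots> \<le> (C + (C\<^sup>2 + K * C) * \<mu> / \<sigma>2) * x powr max (1/2 - \<alpha>) (-1)"
          unfolding p_def using x C K \<mu> \<sigma>2 by (intro mult_left_mono powr_mono add_nonneg_nonneg) auto
        finally show ?case by (simp add: x_def)
      qed
    qed
    ultimately show ?thesis unfolding \<mu>_def \<sigma>2_def by blast
  qed
  show ?thesis using mean(1) light heavy by blast
qed

end
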